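(* (1) $\mathbf{GL}\times\mathbf{S5}$ is product matching; that is, $\mathbf{GL}\times\mathbf{S5}=[\mathbf{GL},\mathbf{S5}]=\mathbf{MGLB}$. (2) $\mathbf{Grz}\times\mathbf{S5}=\mathbf{M}^+\mathbf{GrzB}$.
   Context: Unimodal logics $\mathbf{L}$ are formulated in a propositional language with modality $\Diamond$ ($\Box=\neg\Diamond\neg$), and $\mathbf{S5}$ in a propositional language with modality $\exists$ ($\forall=\neg\exists\neg$). $\mathcal{L}_{\Diamond\exists}$ is the propositional language with both modalities. $\mathbf{GL}$ is the Gödel–Löb logic $\mathbf{K}+\Box(\Box p\to p)\to\Box p$ (its Kripke frames are strict orders without infinite ascending chains) and $\mathbf{Grz}$ is the Grzegorczyk logic $\mathbf{K}+\Box(\Box(p\to\Box p)\to p)\to p$ (its Kripke frames are partial orders without infinite ascending chains). The fusion $\mathbf{L}\otimes\mathbf{S5}$ is the least set of $\mathcal{L}_{\Diamond\exists}$-formulae containing the theorems of $\mathbf{L}$ and $\mathbf{S5}$ and closed under Modus Ponens, Substitution, $\Box$-necessitation, and $\forall$-necessitation. For a logic $\mathbf{M}$ and formulae $\chi_i$, $\mathbf{M}+\chi_1+\dots$ is the least extension of $\mathbf{M}$ containing the $\chi_i$ and closed under these rules. Put $$[\mathbf{L},\mathbf{S5}]=\mathbf{MLB}=(\mathbf{L}\otimes\mathbf{S5})+(\exists\Diamond p\to\Diamond\exists p)+(\Diamond\exists p\to\exists\Diamond p),$$ so that $\mathbf{MGLB}$ and $\mathbf{MGrzB}$ are the cases $\mathbf{L}=\mathbf{GL}$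 and $\mathbf{L}=\mathbf{Grz}$, and $$\mathbf{M}^+\mathbf{GrzB}=\mathbf{MGrzB}+\Box\forall(\Box(\Box p\to\Box\forall p)\to\Box\forall p)\to\Box\forall p.$$ A 2-frame is $(X,R,E)$ with $R$ a binary relation (interpreting $\Diamond$) and $E$ an equivalence relation (interpreting $\exists$) on $X$. For Kripke frames $\mathfrak{F}=(X_1,R_1)$ and $\mathfrak{G}=(X_2,R_2)$ with $R_2$ an equivalence relation, the product frame is $\mathfrak{F}\times\mathfrak{G}=(X_1\times X_2,R,E)$, where $(x,u)R(y,v)$ iff $xR_1y$ and $u=v$, and $(x,u)E(y,v)$ iff $x=y$ and $uR_2v$. For a Kripke complete unimodal logic $\mathbf{L}$, the product logic $\mathbf{L}\times\mathbf{S5}$ is the set of all $\mathcal{L}_{\Diamond\exists}$-formulae valid in all product frames $\mathfrak{F}\times\mathfrak{G}$ with $\mathfrak{F}$ an $\mathbf{L}$-frame and $\mathfrak{G}$ an $\mathbf{S5}$-frame (a set with an equivalence relation). $\mathbf{L}\times\mathbf{S5}$ is called product matching if $\mathbf{L}\times\mathbf{S5}=[\mathbf{L},\mathbf{S5}]$. *)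

theory Defs
  imports Main
begin

section \<open>Modal languages\<close>

text \<open>
  Formulae over a set of modalities given by the type parameter. The unimodal language is
  \<^typ>\<open>unit\<close>-indexed; a logic such as S5 lives in a unimodal language, and is placed into the
  bimodal one by renaming its only modality with the map function of the datatype.
\<close>

datatype 'm fm =
    Atom nat
  | Bot
  | Imp "'m fm" "'m fm"  (infixr \<open>\<rightarrow>\<^sub>m\<close> 60)
  | Poss 'm "'m fm"

definition Neg :: "'m fm \<Rightarrow> 'm fm" where
  "Neg \<phi> = (\<phi> \<rightarrow>\<^sub>m Bot)"

definition Nec :: "'m \<Rightarrow> 'm fm \<Rightarrow> 'm fm" where
  "Nec m \<phi> = Neg (Poss m (Neg \<phi>))"

type_synonym ufm = "unit fm"

abbreviation uDia :: "ufm \<Rightarrow> ufm" where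
  "uDia \<equiv> Poss ()"

abbreviation uBox :: "ufm \<Rightarrow> ufm" where
  "uBox \<equiv> Nec ()"

datatype modality = Diamond | Exist

type_synonym bfm = "modality fm"

abbreviation bDia :: "bfm \<Rightarrow> bfm" where
  "bDia \<equiv> Poss Diamond"

abbreviation bBox :: "bfm \<Rightarrow> bfm" where
  "bBox \<equiv> Nec Diamond"

abbreviation bEx :: "bfm \<Rightarrow> bfm" where
  "bEx \<equiv> Poss Exist"

abbreviation bAll :: "bfm \<Rightarrow> bfm" where
  "bAll \<equiv> Nec Exist"


section \<open>Logics\<close>

primrec subst :: "(nat \<Rightarrow> 'm fm) \<Rightarrow> 'm fm \<Rightarrow> 'm fm" where
  "subst \<sigma> (Atom n) = \<sigma> n"
| "subst \<sigma> Bot = Bot"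
| "subst \<sigma> (\<phi> \<rightarrow>\<^sub>m \<psi>) = (subst \<sigma> \<phi> \<rightarrow>\<^sub>m subst \<sigma> \<psi>)"
| "subst \<sigma> (Poss m \<phi>) = Poss m (subst \<sigma> \<phi>)"

inductive_set closure :: "'m fm set \<Rightarrow> 'm fm set" for \<Gamma> :: "'m fm set" where
  incl: "\<phi> \<in> \<Gamma> \<Longrightarrow> \<phi> \<in> closure \<Gamma>"
| mp: "(\<phi> \<rightarrow>\<^sub>m \<psi>) \<in> closure \<Gamma> \<Longrightarrow> \<phi> \<in> closure \<Gamma> \<Longrightarrow> \<psi> \<in> closure \<Gamma>"
| subst: "\<phi> \<in> closure \<Gamma> \<Longrightarrow> subst \<sigma> \<phi> \<in> closure \<Gamma>"
| nec: "\<phi> \<in> closure \<Gamma> \<Longrightarrow> Nec m \<phi> \<in> closure \<Gamma>"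

definition extend :: "'m fm set \<Rightarrow> 'm fm set \<Rightarrow> 'm fm set" where
  "extend M \<Delta> = closure (M \<union> \<Delta>)"

text \<open>Truth-functional tautologies; \<open>v\<close> is unconstrained on atoms and on modal formulae.\<close>

definition tautology :: "'m fm \<Rightarrow> bool" where
  "tautology \<phi> \<longleftrightarrow>
    (\<forall>v. \<not> v Bot \<and> (\<forall>\<alpha> \<beta>. v (\<alpha> \<rightarrow>\<^sub>m \<beta>) \<longleftrightarrow> (v \<alpha> \<longrightarrow> v \<beta>)) \<longrightarrow> v \<phi>)"

text \<open>
  As the possibility operator is primitive and necessity is defined from it, the distribution
  axiom alone does not make possibility congruential (it never relates \<open>\<diamond>p\<close> to \<open>\<diamond>\<not>\<not>p\<close>), so the
  minimal normal logic also has both halves of the duality axiom \<open>\<diamond>p \<longleftrightarrow> \<not>\<box>\<not>p\<close>.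
\<close>

definition K :: "ufm set" where
  "K = closure ({\<phi>. tautology \<phi>} \<union>
    {uBox (Atom 0 \<rightarrow>\<^sub>m Atom 1) \<rightarrow>\<^sub>m uBox (Atom 0) \<rightarrow>\<^sub>m uBox (Atom 1),
     uDia (Atom 0) \<rightarrow>\<^sub>m Neg (uBox (Neg (Atom 0))),
     Neg (uBox (Neg (Atom 0))) \<rightarrow>\<^sub>m uDia (Atom 0)})"

definition GL :: "ufm set" where
  "GL = extend K {uBox (uBox (Atom 0) \<rightarrow>\<^sub>m Atom 0) \<rightarrow>\<^sub>m uBox (Atom 0)}"

definition Grz :: "ufm set" where
  "Grz = extend K {uBox (uBox (Atom 0 \<rightarrow>\<^sub>m uBox (Atom 0)) \<rightarrow>\<^sub>m Atom 0) \<rightarrow>\<^sub>m Atom 0}"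

definition S5 :: "ufm set" where
  "S5 = extend K
    {Atom 0 \<rightarrow>\<^sub>m uDia (Atom 0),
     uDia (uDia (Atom 0)) \<rightarrow>\<^sub>m uDia (Atom 0),
     Atom 0 \<rightarrow>\<^sub>m uBox (uDia (Atom 0))}"

definition fusion_S5 :: "ufm set \<Rightarrow> bfm set" where
  "fusion_S5 L = closure (map_fm (\<lambda>_. Diamond) ` L \<union> map_fm (\<lambda>_. Exist) ` S5)"

text \<open>\<open>comm_S5 L\<close> is the commutator \<open>[L, S5]\<close>, also called \<open>MLB\<close>.\<close>

definition comm_S5 :: "ufm set \<Rightarrow> bfm set" where
  "comm_S5 L = extend (fusion_S5 L)
    {bEx (bDia (Atom 0)) \<rightarrow>\<^sub>m bDia (bEx (Atom 0)),
     bDia (bEx (Atom 0)) \<rightarrow>\<^sub>m bEx (bDia (Atom 0))}"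

definition MGLB :: "bfm set" where
  "MGLB = comm_S5 GL"

definition MGrzB :: "bfm set" where
  "MGrzB = comm_S5 Grz"

definition MplusGrzB :: "bfm set" where
  "MplusGrzB = extend MGrzB
    {bBox (bAll (bBox (bBox (Atom 0) \<rightarrow>\<^sub>m bBox (bAll (Atom 0))) \<rightarrow>\<^sub>m bBox (bAll (Atom 0))))
       \<rightarrow>\<^sub>m bBox (bAll (Atom 0))}"


section \<open>Kripke semantics and products\<close>

primrec holds :: "('m \<Rightarrow> 'a rel) \<Rightarrow> (nat \<Rightarrow> 'a set) \<Rightarrow> 'a \<Rightarrow> 'm fm \<Rightarrow> bool" where
  "holds R V x (Atom n) \<longleftrightarrow> x \<in> V n"
| "holds R V x Bot \<longleftrightarrow> False"
| "holds R V x (\<phi> \<rightarrow>\<^sub>m \<psi>) \<longleftrightarrow> (holds R V x \<phi> \<longrightarrow> holds R V x \<psi>)"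
| "holds R V x (Poss m \<phi>) \<longleftrightarrow> (\<exists>y. (x, y) \<in> R m \<and> holds R V y \<phi>)"

text \<open>
  Only used when every \<open>R m\<close> is a relation on \<open>X\<close>, so truth at points of \<open>X\<close> depends on
  nothing outside \<open>X\<close>.
\<close>

definition valid :: "'a set \<Rightarrow> ('m \<Rightarrow> 'a rel) \<Rightarrow> 'm fm \<Rightarrow> bool" where
  "valid X R \<phi> \<longleftrightarrow> (\<forall>V. (\<forall>n. V n \<subseteq> X) \<longrightarrow> (\<forall>x\<in>X. holds R V x \<phi>))"

definition frame_for :: "ufm set \<Rightarrow> 'a set \<Rightarrow> 'a rel \<Rightarrow> bool" where
  "frame_for L X R \<longleftrightarrow> R \<subseteq> X \<times> X \<and> (\<forall>\<phi>\<in>L. valid X (\<lambda>_. R) \<phi>)"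

definition prod_rel ::
    "'a set \<Rightarrow> 'a rel \<Rightarrow> 'b set \<Rightarrow> 'b rel \<Rightarrow> modality \<Rightarrow> ('a \<times> 'b) rel" where
  "prod_rel X\<^sub>1 R\<^sub>1 X\<^sub>2 R\<^sub>2 m = (case m of
      Diamond \<Rightarrow> {((x, u), (y, v)). (x, y) \<in> R\<^sub>1 \<and> u = v \<and> u \<in> X\<^sub>2}
    | Exist \<Rightarrow> {((x, u), (y, v)). x = y \<and> x \<in> X\<^sub>1 \<and> (u, v) \<in> R\<^sub>2})"

text \<open>
  A definition in HOL cannot quantify over frames of all types, so the product logic takes the
  types from which the points of the two factors are drawn as parameters. The carriers are
  arbitrary subsets of these types; stating a result for all pairs of infinite types covers product
  frames of every size. For logics whose frames are closed under subframes (GL and Grz), all these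
  choices give the same logic: a refuting product model can be thinned to countable factors
  containing the witnesses it needs. The empty frame is not excluded; it validates everything and
  hence does not affect the logic.
\<close>

definition product_S5 :: "'a itself \<Rightarrow> 'b itself \<Rightarrow> ufm set \<Rightarrow> bfm set" where
  "product_S5 _ _ L = {\<phi>.
    \<forall>(X\<^sub>1 :: 'a set) R\<^sub>1 (X\<^sub>2 :: 'b set) R\<^sub>2.
      frame_for L X\<^sub>1 R\<^sub>1 \<and> equiv X\<^sub>2 R\<^sub>2 \<longrightarrow> valid (X\<^sub>1 \<times> X\<^sub>2) (prod_rel X\<^sub>1 R\<^sub>1 X\<^sub>2 R\<^sub>2) \<phi>}"

definition product_matching :: "'a itself \<Rightarrow> 'b itself \<Rightarrow> ufm set \<Rightarrow> bool" where
  "product_matching A B L \<longleftrightarrow> product_S5 A B L = comm_S5 L"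

end

theory Submission
  imports Defs "HOL-Library.Countable" "HOL-Library.FuncSet" "HOL-Library.Sublist"
begin

text \<open>
  Soundness is fibrewise, except for the extra axiom of \<open>MplusGrzB\<close>, which uses that in a frame for
  \<open>Grz\<close> every nonempty set has a maximal point.

  For completeness, fix a refuted formula and let \<open>\<Sigma>\<close> be its set of subformulas. In the canonical
  model every point has a type (its part of \<open>\<Sigma>\<close>) and every \<open>R Exist\<close>-cluster a quasi-state (the set of
  types of its points). Both are definable, so the axioms apply to them: for a demand
  \<open>\<diamond>a \<in> t \<in> q\<close> there is a point of type \<open>t\<close> and quasi-state \<open>q\<close> with a successor satisfying \<open>a\<close> from
  which \<open>q\<close> cannot be reached any more. For \<open>GL\<close> take a last occurrence of \<open>q\<close>; for \<open>Grz\<close> this needs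
  the extra axiom. As there are finitely many quasi-states, serving all demands yields a finite tree
  labelled with quasi-states. The refuting product has this tree as first factor and as second
  factor the set of runs, which choose a type at every node.
\<close>

section \<open>Normal logics and their canonical models\<close>

text \<open>The Loeb and Grzegorczyk axioms are not canonical, so the canonical model may contain
  ascending chains, and its points carry no coordinates in a product. Passing to types and
  quasi-states loses the identity of a point within its cluster; runs restore it, and the two halves
  of commutation make them exist: one continues a type into a later quasi-state, the other traces a
  later type back. The point that serves a demand need not be the one that raised it, which is
  harmless because only type and quasi-state are recorded. Depth is bounded by the number of
  quasi-states still reachable, which drops whenever some q is left for good. Under Grz, a point may
  have left t within q for good while its cluster still leads back to q; this is the situation that
  the extra axiom excludes.\<close>

lemma tautology_in_K: "tautology \<phi> \<Longrightarrow> \<phi> \<in> K"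
  unfolding K_def by (simp add: closure.incl)

instance modality :: countable
  by countable_datatype

instance fm :: (countable) countable
  by countable_datatype

text \<open>
  Replacing modal subformulas by atoms turns a bimodal tautology into a tautology of the unimodal
  language, of which it is a substitution instance.
\<close>

primrec skeleton :: "'m::countable fm \<Rightarrow> 'n fm" where
  "skeleton (Atom n) = Atom (to_nat (Atom n :: 'm fm))"
| "skeleton Bot = Bot"
| "skeleton (\<phi> \<rightarrow>\<^sub>m \<psi>) = (skeleton \<phi> \<rightarrow>\<^sub>m skeleton \<psi>)"
| "skeleton (Poss m \<phi>) = Atom (to_nat (Poss m \<phi>))"

lemma subst_map_skeleton: "subst from_nat (map_fm f (skeleton \<phi>)) = \<phi>"
  by (induction \<phi>) auto

lemma tautology_skeleton:
  assumes "tautology \<phi>"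
  shows "tautology (skeleton \<phi>)"
  unfolding tautology_def
proof (intro allI impI)
  fix v :: "'b fm \<Rightarrow> bool"
  assume v: "\<not> v Bot \<and> (\<forall>\<alpha> \<beta>. v (\<alpha> \<rightarrow>\<^sub>m \<beta>) \<longleftrightarrow> (v \<alpha> \<longrightarrow> v \<beta>))"
  show "v (skeleton \<phi>)"
    using assms[unfolded tautology_def, rule_format, of "\<lambda>\<psi>. v (skeleton \<psi>)"] v by simp
qed

section \<open>Derivability from hypotheses, maximal consistent sets and the truth lemma\<close>

locale normal_logic =
  fixes L :: "'m fm set"
  assumes taut: "tautology \<phi> \<Longrightarrow> \<phi> \<in> L"
    and distr: "(Nec m (a \<rightarrow>\<^sub>m b) \<rightarrow>\<^sub>m Nec m a \<rightarrow>\<^sub>m Nec m b) \<in> L"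
    and dual1: "(Poss m a \<rightarrow>\<^sub>m Neg (Nec m (Neg a))) \<in> L"
    and dual2: "(Neg (Nec m (Neg a)) \<rightarrow>\<^sub>m Poss m a) \<in> L"
    and modus_ponens: "(a \<rightarrow>\<^sub>m b) \<in> L \<Longrightarrow> a \<in> L \<Longrightarrow> b \<in> L"
    and necessitation: "a \<in> L \<Longrightarrow> Nec m a \<in> L"
begin

text \<open>Necessitation enters only through the theorems of \<open>L\<close>; applied to
  hypotheses it would destroy the deduction theorem.\<close>

inductive ded :: "'m fm set \<Rightarrow> 'm fm \<Rightarrow> bool" for S where
  ded_ax: "a \<in> L \<Longrightarrow> ded S a"
| ded_hyp: "a \<in> S \<Longrightarrow> ded S a"
| ded_mp: "ded S (a \<rightarrow>\<^sub>m b) \<Longrightarrow> ded S a \<Longrightarrow> ded S b"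

lemma ded_taut: "tautology a \<Longrightarrow> ded S a"
  by (simp add: ded_ax taut)

lemma ded_mono: "ded S a \<Longrightarrow> S \<subseteq> T \<Longrightarrow> ded T a"
  by (induction rule: ded.induct) (auto intro: ded.intros)

lemma ded_empty: "ded {} a \<Longrightarrow> a \<in> L"
  by (induction rule: ded.induct) (auto intro: modus_ponens)

lemma ded_finite: "ded S a \<Longrightarrow> \<exists>F. finite F \<and> F \<subseteq> S \<and> ded F a"
proof (induction rule: ded.induct)
  case (ded_ax a)
  then show ?case by (intro exI[of _ "{}"]) (auto intro: ded.intros)
next
  case (ded_hyp a)
  then show ?case by (intro exI[of _ "{a}"]) (auto intro: ded.intros)
next
  case (ded_mp a b)
  then obtain F G where "finite F" "F \<subseteq> S" "ded F (a \<rightarrow>\<^sub>m b)" "finite G" "G \<subseteq> S" "ded G a"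
    by blast
  then show ?case
    by (intro exI[of _ "F \<union> G"]) (auto intro: ded.ded_mp[where a = a] ded_mono)
qed

lemma deduction:
  assumes "ded (insert a S) b"
  shows "ded S (a \<rightarrow>\<^sub>m b)"
  using assms
proof (induction rule: ded.induct)
  case (ded_ax c)
  have "ded S (c \<rightarrow>\<^sub>m a \<rightarrow>\<^sub>m c)" by (rule ded_taut) (simp add: tautology_def)
  then show ?case using ded_ax by (blast intro: ded.intros)
next
  case (ded_hyp c)
  show ?case
  proof (cases "c = a")
    case True
    then show ?thesis by (auto intro!: ded_taut simp: tautology_def)
  next
    case False
    have "ded S (c \<rightarrow>\<^sub>m a \<rightarrow>\<^sub>m c)" by (rule ded_taut) (simp add: tautology_def)
    then show ?thesis using ded_hyp False by (blast intro: ded.intros)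
  qed
next
  case (ded_mp c d)
  have "ded S ((a \<rightarrow>\<^sub>m c \<rightarrow>\<^sub>m d) \<rightarrow>\<^sub>m (a \<rightarrow>\<^sub>m c) \<rightarrow>\<^sub>m a \<rightarrow>\<^sub>m d)"
    by (rule ded_taut) (auto simp: tautology_def)
  then show ?case using ded_mp.IH by (blast intro: ded.intros)
qed

text \<open>This replaces necessitation under hypotheses: boxing a whole derivation boxes its
  hypotheses, and \<open>distr\<close> handles modus ponens.\<close>

lemma ded_Nec: "ded S a \<Longrightarrow> ded (Nec m ` S) (Nec m a)"
proof (induction rule: ded.induct)
  case (ded_mp a b)
  then show ?case by (blast intro: ded.intros distr)
qed (auto intro: ded.intros necessitation)

definition mcs :: "'m fm set \<Rightarrow> bool" where
  "mcs S \<longleftrightarrow> \<not> ded S Bot \<and> (\<forall>a. a \<notin> S \<longrightarrow> ded (insert a S) Bot)"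

text \<open>Zorn's lemma applies since a derivation of \<open>Bot\<close> uses finitely many
  hypotheses, so it would already live in one member of the chain.\<close>

lemma lindenbaum:
  assumes "\<not> ded S Bot"
  obtains T where "mcs T" "S \<subseteq> T"
proof -
  let ?A = "{T. S \<subseteq> T \<and> \<not> ded T Bot}"
  have "\<exists>U\<in>?A. \<forall>T\<in>C. T \<subseteq> U" if C: "subset.chain ?A C" for C
  proof (cases "C = {}")
    case True
    then show ?thesis using assms by auto
  next
    case False
    have "\<not> ded (\<Union>C) Bot"
    proof
      assume "ded (\<Union>C) Bot"
      then obtain F where F: "finite F" "F \<subseteq> \<Union>C" "ded F Bot" using ded_finite by blast
      then obtain T where "T \<in> C" "F \<subseteq> T"
        using finite_subset_Union_chain[OF F(1,2) False, of ?A] C by blast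
      then show False using F(3) C ded_mono by (auto simp: subset.chain_def)
    qed
    moreover have "S \<subseteq> \<Union>C" using False C unfolding subset.chain_def by blast
    ultimately show ?thesis by auto
  qed
  then obtain T where T: "T \<in> ?A" "\<And>U. U \<in> ?A \<Longrightarrow> T \<subseteq> U \<Longrightarrow> U = T"
    using subset_Zorn[of ?A] by auto
  have "mcs T" unfolding mcs_def
  proof (intro conjI allI impI)
    show "\<not> ded T Bot" using T(1) by simp
    fix a assume "a \<notin> T"
    then show "ded (insert a T) Bot" using T(1) T(2)[of "insert a T"] by auto
  qed
  then show ?thesis using T(1) that by auto
qed

lemma mcs_ded: "mcs S \<Longrightarrow> ded S a \<Longrightarrow> a \<in> S"
  unfolding mcs_def by (meson deduction ded_mp)

lemma mcs_ax: "mcs S \<Longrightarrow> a \<in> L \<Longrightarrow> a \<in> S"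
  by (simp add: mcs_ded ded_ax)

lemma mcs_mp: "mcs S \<Longrightarrow> (a \<rightarrow>\<^sub>m b) \<in> S \<Longrightarrow> a \<in> S \<Longrightarrow> b \<in> S"
  by (meson mcs_ded ded_mp ded_hyp)

lemma mcs_Bot: "mcs S \<Longrightarrow> Bot \<notin> S"
  unfolding mcs_def by (blast intro: ded_hyp)

lemma mcs_Imp:
  assumes "mcs S"
  shows "(a \<rightarrow>\<^sub>m b) \<in> S \<longleftrightarrow> (a \<in> S \<longrightarrow> b \<in> S)"
proof
  assume *: "a \<in> S \<longrightarrow> b \<in> S"
  show "(a \<rightarrow>\<^sub>m b) \<in> S"
  proof (cases "a \<in> S")
    case True
    have "(b \<rightarrow>\<^sub>m a \<rightarrow>\<^sub>m b) \<in> S" by (rule mcs_ax[OF assms taut]) (simp add: tautology_def)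
    then show ?thesis using * True assms mcs_mp by blast
  next
    case False
    then have "(a \<rightarrow>\<^sub>m Bot) \<in> S" using assms deduction mcs_ded unfolding mcs_def by blast
    moreover have "((a \<rightarrow>\<^sub>m Bot) \<rightarrow>\<^sub>m a \<rightarrow>\<^sub>m b) \<in> S"
      by (rule mcs_ax[OF assms taut]) (simp add: tautology_def)
    ultimately show ?thesis using assms mcs_mp by blast
  qed
qed (use assms mcs_mp in blast)

lemma mcs_Neg: "mcs S \<Longrightarrow> Neg a \<in> S \<longleftrightarrow> a \<notin> S"
  by (simp add: Neg_def mcs_Imp mcs_Bot)

definition can_rel :: "'m \<Rightarrow> 'm fm set rel" where
  "can_rel m = {(S, T). mcs S \<and> mcs T \<and> (\<forall>a\<in>T. Poss m a \<in> S)}"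

definition can_val :: "nat \<Rightarrow> 'm fm set set" where
  "can_val n = {S. mcs S \<and> Atom n \<in> S}"

text \<open>\<open>T\<close> extends \<open>a\<close> together with everything boxed in
  \<open>S\<close>. Inconsistency of this set would box \<open>Neg a\<close> in \<open>S\<close>,
  against \<open>dual1\<close>; \<open>dual2\<close> turns the inclusion of the unboxed formulas
  into the condition of \<open>can_rel\<close>.\<close>

lemma mcs_Poss:
  assumes S: "mcs S" and a: "Poss m a \<in> S"
  shows "\<exists>T. (S, T) \<in> can_rel m \<and> a \<in> T"
proof -
  let ?N = "{b. Nec m b \<in> S}"
  have "\<not> ded (insert a ?N) Bot"
  proof
    assume "ded (insert a ?N) Bot"
    then have "ded (Nec m ` ?N) (Nec m (Neg a))"
      unfolding Neg_def by (intro ded_Nec deduction)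
    then have "ded S (Nec m (Neg a))" by (rule ded_mono) auto
    then have "Nec m (Neg a) \<in> S" by (rule mcs_ded[OF S])
    moreover have "Neg (Nec m (Neg a)) \<in> S"
      using mcs_mp[OF S mcs_ax[OF S dual1] a] .
    ultimately show False using mcs_Neg[OF S] by blast
  qed
  then obtain T where T: "mcs T" "insert a ?N \<subseteq> T" using lindenbaum by blast
  have "Poss m b \<in> S" if b: "b \<in> T" for b
  proof (rule ccontr)
    assume "Poss m b \<notin> S"
    then have "Neg (Nec m (Neg b)) \<notin> S" using mcs_mp[OF S mcs_ax[OF S dual2]] by blast
    then have "Nec m (Neg b) \<in> S" using mcs_Neg[OF S] by blast
    then have "Neg b \<in> T" using T by blast
    then show False using b mcs_Neg[OF T(1)] by blast
  qed
  then show ?thesis using S T unfolding can_rel_def by blast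
qed

lemma truth: "mcs S \<Longrightarrow> holds can_rel can_val S a \<longleftrightarrow> a \<in> S"
proof (induction a arbitrary: S)
  case (Poss m a)
  then show ?case using mcs_Poss[of S m a] by (auto simp: can_rel_def)
qed (auto simp: can_val_def mcs_Bot mcs_Imp)

lemma canonical_refutation:
  assumes "a \<notin> L"
  shows "\<exists>S. mcs S \<and> \<not> holds can_rel can_val S a"
proof -
  have "\<not> ded {Neg a} Bot"
  proof
    assume "ded {Neg a} Bot"
    then have "Neg (Neg a) \<in> L" unfolding Neg_def by (intro ded_empty deduction)
    moreover have "(Neg (Neg a) \<rightarrow>\<^sub>m a) \<in> L" by (rule taut) (simp add: tautology_def Neg_def)
    ultimately show False using assms modus_ponens by blast
  qed
  then obtain S where "mcs S" "{Neg a} \<subseteq> S" using lindenbaum by blast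
  then show ?thesis using truth mcs_Neg by blast
qed

lemma canonical_sound: "mcs S \<Longrightarrow> a \<in> L \<Longrightarrow> holds can_rel can_val S a"
  by (simp add: truth mcs_ax)

end

lemma holds_Neg [simp]: "holds R V x (Neg a) \<longleftrightarrow> \<not> holds R V x a"
  by (simp add: Neg_def)

lemma holds_Nec [simp]: "holds R V x (Nec m a) \<longleftrightarrow> (\<forall>y. (x, y) \<in> R m \<longrightarrow> holds R V y a)"
  by (simp add: Nec_def)

lemma subst_Neg [simp]: "subst \<sigma> (Neg a) = Neg (subst \<sigma> a)"
  by (simp add: Neg_def)

lemma subst_Nec [simp]: "subst \<sigma> (Nec m a) = Nec m (subst \<sigma> a)"
  by (simp add: Nec_def)

lemma map_fm_Neg [simp]: "map_fm f (Neg a) = Neg (map_fm f a)"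
  by (simp add: Neg_def)

lemma map_fm_Nec [simp]: "map_fm f (Nec m a) = Nec (f m) (map_fm f a)"
  by (simp add: Nec_def)

lemma K_subset_fusion: "K \<subseteq> L \<Longrightarrow> map_fm (\<lambda>_. m) ` K \<subseteq> fusion_S5 L"
proof (cases m)
  case Exist
  have "K \<subseteq> S5" unfolding S5_def extend_def by (auto intro: closure.incl)
  then show ?thesis unfolding Exist fusion_S5_def by (auto intro: closure.incl)
qed (auto simp: fusion_S5_def intro: closure.incl)

lemma normal_logic_closure:
  fixes \<Gamma> :: "bfm set"
  assumes K: "\<And>m. map_fm (\<lambda>_. m) ` K \<subseteq> closure \<Gamma>"
  shows "normal_logic (closure \<Gamma>)"
proof
  fix \<phi> :: bfm
  assume "tautology \<phi>"
  then have "(skeleton \<phi> :: ufm) \<in> K" by (intro tautology_in_K tautology_skeleton)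
  \<comment> \<open>A skeleton contains no modality, so renaming by \<open>Diamond\<close> only
    changes the language in which it is read.\<close>
  then have "subst from_nat (map_fm (\<lambda>_. Diamond) (skeleton \<phi> :: ufm)) \<in> closure \<Gamma>"
    using K by (blast intro: closure.subst)
  then show "\<phi> \<in> closure \<Gamma>" by (simp only: subst_map_skeleton)
next
  fix m and a b :: bfm
  have *: "subst (\<lambda>n. if n = 0 then a else b) (map_fm (\<lambda>_. m) \<psi>) \<in> closure \<Gamma>" if "\<psi> \<in> K" for \<psi>
    using K that by (blast intro: closure.subst)
  have "uBox (Atom 0 \<rightarrow>\<^sub>m Atom 1) \<rightarrow>\<^sub>m uBox (Atom 0) \<rightarrow>\<^sub>m uBox (Atom 1) \<in> K"
    "uDia (Atom 0) \<rightarrow>\<^sub>m Neg (uBox (Neg (Atom 0))) \<in> K"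
    "Neg (uBox (Neg (Atom 0))) \<rightarrow>\<^sub>m uDia (Atom 0) \<in> K"
    unfolding K_def by (auto intro: closure.incl)
  from this[THEN *]
  show "(Nec m (a \<rightarrow>\<^sub>m b) \<rightarrow>\<^sub>m Nec m a \<rightarrow>\<^sub>m Nec m b) \<in> closure \<Gamma>"
    "(Poss m a \<rightarrow>\<^sub>m Neg (Nec m (Neg a))) \<in> closure \<Gamma>"
    "(Neg (Nec m (Neg a)) \<rightarrow>\<^sub>m Poss m a) \<in> closure \<Gamma>"
    by simp_all
qed (auto intro: closure.intros)

section \<open>Soundness\<close>

lemma holds_subst:
  assumes R: "\<And>m. R m \<subseteq> X \<times> X" and "x \<in> X"
  shows "holds R V x (subst \<sigma> a) \<longleftrightarrow> holds R (\<lambda>n. {y \<in> X. holds R V y (\<sigma> n)}) x a"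
  using \<open>x \<in> X\<close>
proof (induction a arbitrary: x)
  case (Poss m a)
  have "y \<in> X" if "(x, y) \<in> R m" for x y using R that by blast
  then show ?case using Poss.IH by auto
qed auto

lemma valid_closure:
  assumes R: "\<And>m. R m \<subseteq> X \<times> X" and \<Gamma>: "\<And>a. a \<in> \<Gamma> \<Longrightarrow> valid X R a"
  assumes "a \<in> closure \<Gamma>"
  shows "valid X R a"
  using assms(3)
proof (induction rule: closure.induct)
  case (subst a \<sigma>)
  then show ?case using holds_subst[of R X, OF R] unfolding valid_def by simp
next
  case (nec a m)
  have "y \<in> X" if "(x, y) \<in> R m" for x y using R that by blast
  then show ?case using nec.IH unfolding valid_def by auto
qed (use \<Gamma> in \<open>auto simp: valid_def\<close>)

lemma holds_tautology: "tautology a \<Longrightarrow> holds R V x a"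
  unfolding tautology_def by (elim allE[of _ "holds R V x"]) simp

section \<open>Frames for S5, GL and Grz\<close>

lemma frame_for_extend_K:
  assumes "R \<subseteq> X \<times> X"
  shows "frame_for (extend K \<Delta>) X R \<longleftrightarrow> (\<forall>a\<in>\<Delta>. valid X (\<lambda>_. R) a)"
proof
  assume "frame_for (extend K \<Delta>) X R"
  then show "\<forall>a\<in>\<Delta>. valid X (\<lambda>_. R) a"
    unfolding frame_for_def extend_def by (auto intro: closure.incl)
next
  assume *: "\<forall>a\<in>\<Delta>. valid X (\<lambda>_. R) a"
  have "valid X (\<lambda>_. R) a" if "a \<in> K" for a
    using that unfolding K_def
    by (rule valid_closure[rotated 2]) (use assms in \<open>auto simp: valid_def holds_tautology\<close>)
  then have "valid X (\<lambda>_. R) a" if "a \<in> extend K \<Delta>" for a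
    using that unfolding extend_def
    by (rule_tac valid_closure[rotated 2]) (use assms * in auto)
  then show "frame_for (extend K \<Delta>) X R" unfolding frame_for_def using assms by blast
qed

lemma frame_forD:
  "frame_for L X R \<Longrightarrow> a \<in> L \<Longrightarrow> \<forall>n. V n \<subseteq> X \<Longrightarrow> x \<in> X \<Longrightarrow> holds (\<lambda>_. R) V x a"
  by (simp add: frame_for_def valid_def)

lemma frame_for_S5:
  assumes "equiv X R"
  shows "frame_for S5 X R"
proof -
  have R: "R \<subseteq> X \<times> X" "\<And>x. x \<in> X \<Longrightarrow> (x, x) \<in> R"
    "\<And>x y z. (x, y) \<in> R \<Longrightarrow> (y, z) \<in> R \<Longrightarrow> (x, z) \<in> R" "\<And>x y. (x, y) \<in> R \<Longrightarrow> (y, x) \<in> R"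
    using assms by (auto simp: equiv_def refl_on_def dest: symD transD)
  show ?thesis
    unfolding S5_def frame_for_extend_K[OF R(1)] 
    by (auto simp: valid_def) (use R in meson)+
qed

text \<open>Loeb's axiom is induction along the converse relation: its premise is the induction
  step, and transitivity keeps the induction among the successors of the starting point.\<close>

lemma frame_for_GL:
  assumes R: "R \<subseteq> X \<times> X" "trans R" "wf (R\<inverse>)"
  shows "frame_for GL X R"
proof -
  have "x \<in> P" if "\<And>y. \<lbrakk>(w, y) \<in> R; \<And>z. (y, z) \<in> R \<Longrightarrow> z \<in> P\<rbrakk> \<Longrightarrow> y \<in> P" "(w, x) \<in> R" for P w x
    using R(3) that(2)
  proof (induction x rule: wf_induct_rule)
    case (less x)
    show ?case using less that(1) transD[OF R(2)] by blast
  qed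
  then show ?thesis
    unfolding GL_def frame_for_extend_K[OF R(1)] by (auto simp: valid_def)
qed

lemma frame_for_Grz:
  assumes R: "R \<subseteq> X \<times> X" "refl_on X R" "trans R" "wf ((R - Id)\<inverse>)"
  shows "frame_for Grz X R"
proof -
  have Grz: "\<exists>y\<in>P. (x, y) \<in> R \<and> (\<forall>z. (y, z) \<in> R \<longrightarrow> z \<notin> P \<longrightarrow> (\<forall>w. (z, w) \<in> R \<longrightarrow> w \<notin> P))"
    if P: "P \<subseteq> X" "x \<in> P" for P x
  proof -
    \<comment> \<open>A maximal point \<open>y\<close> of \<open>P\<close> above \<open>x\<close> is
      chosen. After leaving \<open>P\<close>, a return could only lead to \<open>y\<close> itself
      and would close a cycle.\<close>
    have "x \<in> {y \<in> P. (x, y) \<in> R}" using P R(2) by (auto simp: refl_on_def)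
    then obtain y where y: "y \<in> P" "(x, y) \<in> R"
      and max: "\<And>z. (y, z) \<in> R - Id \<Longrightarrow> z \<notin> {y \<in> P. (x, y) \<in> R}"
      using wfE_min[OF R(4)] by (metis (no_types, lifting) converse_iff mem_Collect_eq)
    have no: "z = y" if "(y, z) \<in> R" "z \<in> P" for z
      using max[of z] that y transD[OF R(3)] by blast
    have "w \<notin> P" if "(y, z) \<in> R" "z \<notin> P" "(z, w) \<in> R" for z w
    proof
      assume "w \<in> P"
      then have "w = y" using no that transD[OF R(3)] by blast
      then have "(y, z) \<in> R - Id" "(z, y) \<in> R - Id" using that y by auto
      then show False using wf_not_sym[OF R(4)] by (meson converse_iff)
    qed
    then show ?thesis using y by blast
  qed
  have "x \<in> Q"
    if Q: "Q \<subseteq> X" "x \<in> X" and *: "\<And>y. \<lbrakk>(x, y) \<in> R;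
        \<And>z. \<lbrakk>(y, z) \<in> R; z \<in> Q\<rbrakk> \<Longrightarrow> (\<forall>w. (z, w) \<in> R \<longrightarrow> w \<in> Q)\<rbrakk> \<Longrightarrow> y \<in> Q" for Q x
  proof (rule ccontr)
    assume "x \<notin> Q"
    then obtain y where y: "y \<in> X - Q" "(x, y) \<in> R"
      "\<And>z w. (y, z) \<in> R \<Longrightarrow> z \<notin> X - Q \<Longrightarrow> (z, w) \<in> R \<Longrightarrow> w \<notin> X - Q"
      using Grz[of "X - Q" x] Q by blast
    have "y \<in> Q"
    proof (rule *[OF y(2)])
      fix z assume "(y, z) \<in> R" "z \<in> Q"
      then show "\<forall>w. (z, w) \<in> R \<longrightarrow> w \<in> Q" using y(3) R(1) by blast
    qed
    then show False using y by blast
  qed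
  note * = this
  have "holds (\<lambda>_. R) V x (uBox (uBox (Atom 0 \<rightarrow>\<^sub>m uBox (Atom 0)) \<rightarrow>\<^sub>m Atom 0) \<rightarrow>\<^sub>m Atom 0)"
    if "\<forall>n. V n \<subseteq> X" "x \<in> X" for V x
    using *[of "V 0" x] that unfolding holds.simps holds_Nec by blast
  then show ?thesis
    unfolding Grz_def frame_for_extend_K[OF R(1)] valid_def by blast
qed

abbreviation Grz_instance :: "'m \<Rightarrow> 'm fm \<Rightarrow> 'm fm" where
  "Grz_instance m a \<equiv> Nec m (Nec m (a \<rightarrow>\<^sub>m Nec m a) \<rightarrow>\<^sub>m a) \<rightarrow>\<^sub>m a"

lemma Grz_instance_reflexive:
  assumes "\<And>a. holds R V x (Grz_instance m a)" "holds R V x a"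
  shows "holds R V x (Poss m a)"
  using assms(1)[of "Neg a"] assms(2) by auto

text \<open>Here \<open>?b\<close> is the conjunction of \<open>a\<close> with the implication from
  \<open>Nec m a\<close> to \<open>Nec m (Nec m a)\<close>. If \<open>Nec m a\<close> failed at a
  successor \<open>z\<close> of \<open>y\<close> where \<open>a\<close> holds, the implication would
  be vacuous there, so \<open>?b\<close> and then \<open>Nec m ?b\<close> would hold at
  \<open>z\<close>, forcing \<open>Nec m a\<close> after all.\<close>

lemma Grz_instance_transitive:
  assumes "\<And>a. holds R V x (Grz_instance m a)" "holds R V x (Nec m a)"
  shows "holds R V x (Nec m (Nec m a))"
proof -
  let ?b = "Neg (a \<rightarrow>\<^sub>m Neg (Nec m a \<rightarrow>\<^sub>m Nec m (Nec m a)))"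
  have b: "holds R V y ?b \<longleftrightarrow>
      holds R V y a \<and> (holds R V y (Nec m a) \<longrightarrow> holds R V y (Nec m (Nec m a)))" for y
    unfolding holds_Neg holds.simps by blast
  have "holds R V y ?b" if y: "(x, y) \<in> R m" "holds R V y (Nec m (?b \<rightarrow>\<^sub>m Nec m ?b))" for y
  proof -
    have "holds R V z (Nec m a)" if z: "(y, z) \<in> R m" "holds R V z a" for z
    proof (rule ccontr)
      assume no: "\<not> holds R V z (Nec m a)"
      then have "holds R V z (Nec m ?b)"
        using y(2) z unfolding holds_Nec[of _ _ y] holds.simps(3) b by blast
      then show False using no unfolding holds_Nec b by blast
    qed
    then show ?thesis
      using y(1) assms(2) unfolding b by (simp del: holds_Nec add: holds_Nec[of _ _ y] holds_Nec[of _ _ x])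
  qed
  then have "holds R V x (Nec m (Nec m (?b \<rightarrow>\<^sub>m Nec m ?b) \<rightarrow>\<^sub>m ?b))"
    unfolding holds_Nec[of _ _ x] holds.simps(3) by blast
  then have "holds R V x ?b" using assms(1)[of ?b] unfolding holds.simps(3)[of _ _ x] by blast
  then show ?thesis using assms(2) unfolding b by blast
qed

text \<open>Contraposed for the valuation \<open>P\<close>, the axiom yields a point of
  \<open>P\<close> from which \<open>P\<close> cannot be left and re-entered. A singleton
  \<open>P\<close> gives reflexivity and antisymmetry, and a set met infinitely often by a chain,
  with gaps, gives converse well-foundedness; transitivity comes from the derived axiom 4.\<close>

lemma Grz_frameD:
  assumes "frame_for Grz X R"
  shows "R \<subseteq> X \<times> X" "refl_on X R" "trans R" "wf ((R - Id)\<inverse>)"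
proof -
  show R: "R \<subseteq> X \<times> X" using assms by (simp add: frame_for_def)
  have inst: "holds (\<lambda>_. R) V x (Grz_instance () a)" if "x \<in> X" "\<And>n. V n \<subseteq> X" for V x a
  proof -
    have "Grz_instance () (Atom 0) \<in> Grz"
      unfolding Grz_def extend_def by (auto intro: closure.incl)
    then have "subst (\<lambda>_. a) (Grz_instance () (Atom 0)) \<in> Grz"
      unfolding Grz_def extend_def by (rule closure.subst)
    then show ?thesis using assms that unfolding frame_for_def valid_def by auto
  qed
  have Grz: "\<exists>y\<in>P. (x, y) \<in> R \<and> (\<forall>z w. (y, z) \<in> R \<longrightarrow> z \<notin> P \<longrightarrow> (z, w) \<in> R \<longrightarrow> w \<notin> P)"
    if P: "P \<subseteq> X" "x \<in> P" for P x
    using inst[of x "\<lambda>_. P" "Neg (Atom 0)"] P by auto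
  show refl: "refl_on X R"
    using Grz[of "{x}" x for x] by (auto simp: refl_on_def)
  show trans: "trans R"
  proof (rule transI)
    fix x y z assume xyz: "(x, y) \<in> R" "(y, z) \<in> R"
    then have "holds (\<lambda>_. R) (\<lambda>_. {w. (x, w) \<in> R}) x (Nec () (Nec () (Atom 0)))"
    proof (intro Grz_instance_transitive)
      show "holds (\<lambda>_. R) (\<lambda>_. {w. (x, w) \<in> R}) x (Grz_instance () a)" for a
        by (rule inst) (use xyz R in auto)
    qed auto
    then show "(x, z) \<in> R" using xyz by auto
  qed
  have antisym: "x = y" if "(x, y) \<in> R" "(y, x) \<in> R" for x y
    using Grz[of "{x}" x] that R by blast
  show "wf ((R - Id)\<inverse>)"
    unfolding wf_iff_no_infinite_down_chain
  proof
    assume "\<exists>f. \<forall>i. (f (Suc i), f i) \<in> (R - Id)\<inverse>"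
    then obtain f where f: "\<And>i. (f i, f (Suc i)) \<in> R - Id" by auto
    have le: "(f i, f j) \<in> R" if "i \<le> j" for i j
      using that
    proof (induction rule: dec_induct)
      case base
      then show ?case using refl f[of i] R by (auto simp: refl_on_def)
    next
      case (step n)
      then show ?case using f[of n] transD[OF trans] by blast
    qed
    have neq: "f i \<noteq> f j" if "i < j" for i j
    proof
      assume "f i = f j"
      then have "(f (Suc i), f i) \<in> R" using le[of "Suc i" j] that by simp
      then show False using antisym f[of i] by blast
    qed
    \<comment> \<open>the even members of the chain form a set that is left and re-entered again and again\<close>
    let ?P = "range (\<lambda>i. f (2 * i))"
    have odd: "f (Suc (2 * i)) \<notin> ?P" for i
    proof
      assume "f (Suc (2 * i)) \<in> ?P"
      then obtain j where "f (Suc (2 * i)) = f (2 * j)" by blast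
      then have "Suc (2 * i) = 2 * j" using neq by (metis nat_neq_iff)
      then show False by presburger
    qed
    have "?P \<subseteq> X" using f R by blast
    then obtain i where "\<And>z w. (f (2 * i), z) \<in> R \<Longrightarrow> z \<notin> ?P \<Longrightarrow> (z, w) \<in> R \<Longrightarrow> w \<notin> ?P"
      using Grz[of ?P "f (2 * 0)"] by blast
    from this[of "f (Suc (2 * i))" "f (Suc (Suc (2 * i)))"]
    have "f (Suc (Suc (2 * i))) \<notin> ?P" using f odd by blast
    moreover have "f (2 * Suc i) \<in> ?P" by blast
    ultimately show False by simp
  qed
qed

section \<open>Sections of a product frame and validity in it\<close>

lemma holds_prod_Diamond:
  "u \<in> X\<^sub>2 \<Longrightarrow> holds (prod_rel X\<^sub>1 R\<^sub>1 X\<^sub>2 R\<^sub>2) V (x, u) (map_fm (\<lambda>_. Diamond) a)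
    \<longleftrightarrow> holds (\<lambda>_. R\<^sub>1) (\<lambda>n. {y. (y, u) \<in> V n}) x a"
  by (induction a arbitrary: x) (auto simp: prod_rel_def)

lemma holds_prod_Exist:
  "x \<in> X\<^sub>1 \<Longrightarrow> holds (prod_rel X\<^sub>1 R\<^sub>1 X\<^sub>2 R\<^sub>2) V (x, u) (map_fm (\<lambda>_. Exist) a)
    \<longleftrightarrow> holds (\<lambda>_. R\<^sub>2) (\<lambda>n. {v. (x, v) \<in> V n}) u a"
  by (induction a arbitrary: u) (auto simp: prod_rel_def)

lemma prod_rel_subset:
  "R\<^sub>1 \<subseteq> X\<^sub>1 \<times> X\<^sub>1 \<Longrightarrow> R\<^sub>2 \<subseteq> X\<^sub>2 \<times> X\<^sub>2 \<Longrightarrow> prod_rel X\<^sub>1 R\<^sub>1 X\<^sub>2 R\<^sub>2 m \<subseteq> (X\<^sub>1 \<times> X\<^sub>2) \<times> X\<^sub>1 \<times> X\<^sub>2"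
  by (cases m) (auto simp: prod_rel_def)

text \<open>An axiom of one factor is evaluated inside a single row or column, which is a copy of
  that factor under the restricted valuation. Only the commutation axioms see both
  directions.\<close>

lemma prod_valid_comm_S5:
  assumes F: "frame_for L X\<^sub>1 R\<^sub>1" and E: "equiv X\<^sub>2 R\<^sub>2" and a: "a \<in> comm_S5 L"
  shows "valid (X\<^sub>1 \<times> X\<^sub>2) (prod_rel X\<^sub>1 R\<^sub>1 X\<^sub>2 R\<^sub>2) a"
proof -
  have R2: "R\<^sub>2 \<subseteq> X\<^sub>2 \<times> X\<^sub>2" using E by (auto simp: equiv_def)
  have R1: "R\<^sub>1 \<subseteq> X\<^sub>1 \<times> X\<^sub>1" using F by (simp add: frame_for_def)
  note R = prod_rel_subset[OF R1 R2]
  have 1: "valid (X\<^sub>1 \<times> X\<^sub>2) (prod_rel X\<^sub>1 R\<^sub>1 X\<^sub>2 R\<^sub>2) (map_fm (\<lambda>_. Diamond) b)" if "b \<in> L" for b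
    unfolding valid_def
  proof (intro allI impI ballI)
    fix V :: "nat \<Rightarrow> _" and p assume V: "\<forall>n. V n \<subseteq> X\<^sub>1 \<times> X\<^sub>2" and "p \<in> X\<^sub>1 \<times> X\<^sub>2"
    then obtain x u where p: "p = (x, u)" "x \<in> X\<^sub>1" "u \<in> X\<^sub>2" by blast
    have "\<forall>n. {y. (y, u) \<in> V n} \<subseteq> X\<^sub>1" using V by blast
    then have "holds (\<lambda>_. R\<^sub>1) (\<lambda>n. {y. (y, u) \<in> V n}) x b"
      by (rule frame_forD[OF F that _ p(2)])
    then show "holds (prod_rel X\<^sub>1 R\<^sub>1 X\<^sub>2 R\<^sub>2) V p (map_fm (\<lambda>_. Diamond) b)"
      unfolding p(1) holds_prod_Diamond[OF p(3)] .
  qed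
  have 2: "valid (X\<^sub>1 \<times> X\<^sub>2) (prod_rel X\<^sub>1 R\<^sub>1 X\<^sub>2 R\<^sub>2) (map_fm (\<lambda>_. Exist) b)" if "b \<in> S5" for b
    unfolding valid_def
  proof (intro allI impI ballI)
    fix V :: "nat \<Rightarrow> _" and p assume V: "\<forall>n. V n \<subseteq> X\<^sub>1 \<times> X\<^sub>2" and "p \<in> X\<^sub>1 \<times> X\<^sub>2"
    then obtain x u where p: "p = (x, u)" "x \<in> X\<^sub>1" "u \<in> X\<^sub>2" by blast
    have "\<forall>n. {v. (x, v) \<in> V n} \<subseteq> X\<^sub>2" using V by blast
    then have "holds (\<lambda>_. R\<^sub>2) (\<lambda>n. {v. (x, v) \<in> V n}) u b"
      by (rule frame_forD[OF frame_for_S5[OF E] that _ p(3)])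
    then show "holds (prod_rel X\<^sub>1 R\<^sub>1 X\<^sub>2 R\<^sub>2) V p (map_fm (\<lambda>_. Exist) b)"
      unfolding p(1) holds_prod_Exist[OF p(2)] .
  qed
  have 3: "valid (X\<^sub>1 \<times> X\<^sub>2) (prod_rel X\<^sub>1 R\<^sub>1 X\<^sub>2 R\<^sub>2) b" if "b \<in> fusion_S5 L" for b
    using that 1 2 unfolding fusion_S5_def by (rule_tac valid_closure[OF R]) auto
  show ?thesis
    using a unfolding comm_S5_def extend_def
  proof (rule valid_closure[OF R, rotated])
    fix b assume b: "b \<in> fusion_S5 L \<union> {bEx (bDia (Atom 0)) \<rightarrow>\<^sub>m bDia (bEx (Atom 0)),
      bDia (bEx (Atom 0)) \<rightarrow>\<^sub>m bEx (bDia (Atom 0))}"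
    show "valid (X\<^sub>1 \<times> X\<^sub>2) (prod_rel X\<^sub>1 R\<^sub>1 X\<^sub>2 R\<^sub>2) b"
    proof (cases "b \<in> fusion_S5 L")
      case False
      then show ?thesis using b R1 R2 by (fastforce simp: valid_def prod_rel_def)
    qed (rule 3)
  qed
qed

text \<open>With \<open>S\<close> as the truth set of the variable, the extra axiom becomes an
  induction along the converse of the strict part of the first relation, performed for all points of
  an equivalence class at once.\<close>

lemma prod_valid_MplusGrzB:
  assumes F: "frame_for Grz X\<^sub>1 R\<^sub>1" and E: "equiv X\<^sub>2 R\<^sub>2" and a: "a \<in> MplusGrzB"
  shows "valid (X\<^sub>1 \<times> X\<^sub>2) (prod_rel X\<^sub>1 R\<^sub>1 X\<^sub>2 R\<^sub>2) a"
proof -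
  note R1 = Grz_frameD[OF F]
  have R2: "R\<^sub>2 \<subseteq> X\<^sub>2 \<times> X\<^sub>2" "sym R\<^sub>2" "trans R\<^sub>2" "\<And>u. u \<in> X\<^sub>2 \<Longrightarrow> (u, u) \<in> R\<^sub>2"
    using E by (auto simp: equiv_def refl_on_def)
  show ?thesis
    using a unfolding MplusGrzB_def extend_def
  proof (rule valid_closure[OF prod_rel_subset[OF R1(1) R2(1)], rotated])
    fix b assume b: "b \<in> MGrzB \<union> {bBox (bAll (bBox (bBox (Atom 0) \<rightarrow>\<^sub>m bBox (bAll (Atom 0)))
      \<rightarrow>\<^sub>m bBox (bAll (Atom 0)))) \<rightarrow>\<^sub>m bBox (bAll (Atom 0))}"
    show "valid (X\<^sub>1 \<times> X\<^sub>2) (prod_rel X\<^sub>1 R\<^sub>1 X\<^sub>2 R\<^sub>2) b"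
    proof (cases "b \<in> MGrzB")
      case True
      then show ?thesis using prod_valid_comm_S5[OF F E] by (simp add: MGrzB_def)
    next
      case False
      have "(y', v') \<in> S"
        if x: "x \<in> X\<^sub>1" "u \<in> X\<^sub>2"
          and step: "\<And>y v. \<lbrakk>(x, y) \<in> R\<^sub>1; (u, v) \<in> R\<^sub>2;
            \<And>z. \<lbrakk>(y, z) \<in> R\<^sub>1; \<And>w. (z, w) \<in> R\<^sub>1 \<Longrightarrow> (w, v) \<in> S\<rbrakk>
              \<Longrightarrow> \<forall>w v'. (z, w) \<in> R\<^sub>1 \<longrightarrow> (v, v') \<in> R\<^sub>2 \<longrightarrow> (w, v') \<in> S\<rbrakk>
            \<Longrightarrow> \<forall>w v'. (y, w) \<in> R\<^sub>1 \<longrightarrow> (v, v') \<in> R\<^sub>2 \<longrightarrow> (w, v') \<in> S"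
          and y': "(x, y') \<in> R\<^sub>1" "(u, v') \<in> R\<^sub>2"
        for S x u y' v'
        using R1(4) y'
      proof (induction y' arbitrary: v' rule: wf_induct_rule)
        case (less y)
        have y: "(y, y) \<in> R\<^sub>1" "(v', v') \<in> R\<^sub>2" using less.prems R1 R2 by (auto simp: refl_on_def)
        show ?case
        proof (rule ccontr)
          assume no: "(y, v') \<notin> S"
          \<comment> \<open>A counterexample at \<open>y\<close> makes the hypothesis of
            \<open>step\<close> true: \<open>z = y\<close> violates its premise because
            \<open>y\<close> sees itself, and strictly above \<open>y\<close> the induction
            hypothesis covers the whole class.\<close>
          have "\<forall>w v''. (y, w) \<in> R\<^sub>1 \<longrightarrow> (v', v'') \<in> R\<^sub>2 \<longrightarrow> (w, v'') \<in> S"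
          proof (rule step[OF less.prems])
            fix z assume z: "(y, z) \<in> R\<^sub>1" and w: "\<And>w. (z, w) \<in> R\<^sub>1 \<Longrightarrow> (w, v') \<in> S"
            have "z \<noteq> y" using no w y by blast
            show "\<forall>w v''. (z, w) \<in> R\<^sub>1 \<longrightarrow> (v', v'') \<in> R\<^sub>2 \<longrightarrow> (w, v'') \<in> S"
            proof (intro allI impI)
              fix w v'' assume w: "(z, w) \<in> R\<^sub>1" "(v', v'') \<in> R\<^sub>2"
              have "w \<noteq> y"
                using w z \<open>z \<noteq> y\<close> wf_not_sym[OF R1(4), of y z] by blast
              then show "(w, v'') \<in> S"
                using less.IH[of w v''] w z less.prems transD[OF R1(3)] transD[OF R2(3)] by blast
            qed
          qed
          then show False using no y by blast
        qed
      qed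
      note * = this
      from b False have b: "b = bBox (bAll (bBox (bBox (Atom 0) \<rightarrow>\<^sub>m bBox (bAll (Atom 0)))
        \<rightarrow>\<^sub>m bBox (bAll (Atom 0)))) \<rightarrow>\<^sub>m bBox (bAll (Atom 0))" by blast
      show ?thesis
        unfolding valid_def
      proof (intro allI impI ballI)
        fix V :: "nat \<Rightarrow> _" and p assume p: "p \<in> X\<^sub>1 \<times> X\<^sub>2"
        let ?R = "prod_rel X\<^sub>1 R\<^sub>1 X\<^sub>2 R\<^sub>2"
        obtain x u where xu: "p = (x, u)" "x \<in> X\<^sub>1" "u \<in> X\<^sub>2" using p by blast
        have box: "holds ?R V (y, v) (bBox c) \<longleftrightarrow> (\<forall>z. (y, z) \<in> R\<^sub>1 \<longrightarrow> holds ?R V (z, v) c)"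
          if "v \<in> X\<^sub>2" for y v c using that by (auto simp: prod_rel_def)
        have all: "holds ?R V (y, v) (bAll c) \<longleftrightarrow> (\<forall>v'. (v, v') \<in> R\<^sub>2 \<longrightarrow> holds ?R V (y, v') c)"
          if "y \<in> X\<^sub>1" for y v c using that by (auto simp: prod_rel_def)
        have X: "y \<in> X\<^sub>1" "z \<in> X\<^sub>1" if "(y, z) \<in> R\<^sub>1" for y z using that R1(1) by auto
        have Y: "v \<in> X\<^sub>2" "v' \<in> X\<^sub>2" if "(v, v') \<in> R\<^sub>2" for v v' using that R2(1) by auto
        have ba: "holds ?R V (y, v) (bBox (bAll c)) \<longleftrightarrow>
            (\<forall>w v'. (y, w) \<in> R\<^sub>1 \<longrightarrow> (v, v') \<in> R\<^sub>2 \<longrightarrow> holds ?R V (w, v') c)"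
          if "v \<in> X\<^sub>2" for y v c using box[OF that] all X by blast
        show "holds ?R V p b"
          unfolding b xu(1) holds.simps(3) ba[OF xu(3)]
        proof (intro impI allI)
          fix y' v'
          assume prem: "\<forall>w v'. (x, w) \<in> R\<^sub>1 \<longrightarrow> (u, v') \<in> R\<^sub>2 \<longrightarrow>
              holds ?R V (w, v') (bBox (bBox (Atom 0) \<rightarrow>\<^sub>m bBox (bAll (Atom 0)))) \<longrightarrow>
              holds ?R V (w, v') (bBox (bAll (Atom 0)))"
            and y': "(x, y') \<in> R\<^sub>1" "(u, v') \<in> R\<^sub>2"
          have "(y', v') \<in> V 0"
          proof (rule *[OF xu(2,3) _ y'])
            fix y v
            assume yv: "(x, y) \<in> R\<^sub>1" "(u, v) \<in> R\<^sub>2"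
              and h: "\<And>z. \<lbrakk>(y, z) \<in> R\<^sub>1; \<And>w. (z, w) \<in> R\<^sub>1 \<Longrightarrow> (w, v) \<in> V 0\<rbrakk>
                \<Longrightarrow> \<forall>w v'. (z, w) \<in> R\<^sub>1 \<longrightarrow> (v, v') \<in> R\<^sub>2 \<longrightarrow> (w, v') \<in> V 0"
            have v: "v \<in> X\<^sub>2" using Y yv by blast
            have "holds ?R V (y, v) (bBox (bBox (Atom 0) \<rightarrow>\<^sub>m bBox (bAll (Atom 0))))"
              by (subst box[OF v], unfold holds.simps(3) ba[OF v], unfold box[OF v] holds.simps(1)) (use h in blast)
            then have "holds ?R V (y, v) (bBox (bAll (Atom 0)))" using prem yv by blast
            then show "\<forall>w v'. (y, w) \<in> R\<^sub>1 \<longrightarrow> (v, v') \<in> R\<^sub>2 \<longrightarrow> (w, v') \<in> V 0"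
              unfolding ba[OF v] holds.simps(1) .
          qed
          then show "holds ?R V (y', v') (Atom 0)" by simp
        qed
      qed
    qed
  qed
qed

section \<open>Types and quasi-states in commutative models\<close>

text \<open>Commutation is assumed for the truth of formulas, so it is applied to definable
  properties. \<open>\<Sigma>\<close> is finite to make types definable by finite
  conjunctions.\<close>

locale comm_model =
  fixes W :: "'w set" and R :: "modality \<Rightarrow> 'w rel" and V :: "nat \<Rightarrow> 'w set" and \<Sigma> :: "bfm set"
  assumes rel: "R m \<subseteq> W \<times> W"
    and trans_Diamond: "trans (R Diamond)"
    and equiv_Exist: "equiv W (R Exist)"
    and commute: "x \<in> W \<Longrightarrow> holds R V x (bEx (bDia a)) \<longleftrightarrow> holds R V x (bDia (bEx a))"
    and finite_\<Sigma>: "finite \<Sigma>"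
    and \<Sigma>_Imp: "(a \<rightarrow>\<^sub>m b) \<in> \<Sigma> \<Longrightarrow> a \<in> \<Sigma> \<and> b \<in> \<Sigma>"
    and \<Sigma>_Poss: "Poss m a \<in> \<Sigma> \<Longrightarrow> a \<in> \<Sigma>"
begin

lemma rel_W: "(x, y) \<in> R m \<Longrightarrow> x \<in> W \<and> y \<in> W"
  using rel by blast

lemma E_refl: "x \<in> W \<Longrightarrow> (x, x) \<in> R Exist"
  using equiv_Exist unfolding equiv_def by (blast dest: refl_onD)

lemma E_sym: "(x, y) \<in> R Exist \<Longrightarrow> (y, x) \<in> R Exist"
  using equiv_Exist unfolding equiv_def by (blast dest: symD)

lemma E_trans: "(x, y) \<in> R Exist \<Longrightarrow> (y, z) \<in> R Exist \<Longrightarrow> (x, z) \<in> R Exist"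
  using equiv_Exist unfolding equiv_def by (blast dest: transD)

lemma D_trans: "(x, y) \<in> R Diamond \<Longrightarrow> (y, z) \<in> R Diamond \<Longrightarrow> (x, z) \<in> R Diamond"
  using trans_Diamond by (rule transD)

definition definable :: "('w \<Rightarrow> bool) \<Rightarrow> bool" where
  "definable P \<longleftrightarrow> (\<exists>a. \<forall>x\<in>W. holds R V x a \<longleftrightarrow> P x)"

lemma definable_cong: "definable P \<Longrightarrow> (\<And>x. x \<in> W \<Longrightarrow> P x \<longleftrightarrow> Q x) \<Longrightarrow> definable Q"
  unfolding definable_def by blast

lemma definable_holds: "definable (\<lambda>x. holds R V x a)"
  unfolding definable_def by blast

lemma definable_const: "definable (\<lambda>_. b)"
  unfolding definable_def
  by (rule exI[of _ "if b then Neg Bot else Bot"]) simp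

lemma definable_imp:
  assumes "definable P" "definable Q"
  shows "definable (\<lambda>x. P x \<longrightarrow> Q x)"
proof -
  obtain a b where "\<forall>x\<in>W. holds R V x a \<longleftrightarrow> P x" "\<forall>x\<in>W. holds R V x b \<longleftrightarrow> Q x"
    using assms unfolding definable_def by blast
  then have "\<forall>x\<in>W. holds R V x (a \<rightarrow>\<^sub>m b) \<longleftrightarrow> (P x \<longrightarrow> Q x)" by simp
  then show ?thesis unfolding definable_def by blast
qed

lemma definable_not:
  assumes "definable P"
  shows "definable (\<lambda>x. \<not> P x)"
  using definable_imp[OF assms definable_const[of False]] by simp

lemma definable_conj:
  assumes "definable P" "definable Q"
  shows "definable (\<lambda>x. P x \<and> Q x)"
  using definable_not[OF definable_imp[OF assms(1) definable_not[OF assms(2)]]] by simp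

lemma definable_eq_const: "definable P \<Longrightarrow> definable (\<lambda>x. P x \<longleftrightarrow> b)"
  by (cases b) (simp_all add: definable_not)

lemma definable_Poss:
  assumes "definable P"
  shows "definable (\<lambda>x. \<exists>y. (x, y) \<in> R m \<and> P y)"
proof -
  obtain a where "\<forall>x\<in>W. holds R V x a \<longleftrightarrow> P x" using assms unfolding definable_def by blast
  then have "\<forall>x\<in>W. holds R V x (Poss m a) \<longleftrightarrow> (\<exists>y. (x, y) \<in> R m \<and> P y)"
    using rel_W by auto
  then show ?thesis unfolding definable_def by blast
qed

lemma definable_Ball:
  "finite A \<Longrightarrow> (\<And>i. i \<in> A \<Longrightarrow> definable (P i)) \<Longrightarrow> definable (\<lambda>x. \<forall>i\<in>A. P i x)"
proof (induction rule: finite_induct)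
  case empty
  then show ?case using definable_const[of True] by simp
next
  case (insert i A)
  then show ?case using definable_conj[of "P i" "\<lambda>x. \<forall>i\<in>A. P i x"] by simp
qed

definition tp :: "'w \<Rightarrow> bfm set" where
  "tp x = {a \<in> \<Sigma>. holds R V x a}"

definition qs :: "'w \<Rightarrow> bfm set set" where
  "qs x = tp ` (R Exist `` {x})"

text \<open>The cardinality of this set is the induction measure for building trees. The point
  itself is added because \<open>R Diamond\<close> may fail to be reflexive.\<close>

definition reach :: "'w \<Rightarrow> bfm set set set" where
  "reach x = {qs z | z. z = x \<or> (x, z) \<in> R Diamond}"

lemma tp_in_qs: "x \<in> W \<Longrightarrow> tp x \<in> qs x"
  unfolding qs_def using E_refl by blast

lemma in_qsE:
  assumes "t \<in> qs x"
  obtains y where "(x, y) \<in> R Exist" "tp y = t"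
  using assms unfolding qs_def by blast

lemma definable_tp: "definable (\<lambda>x. tp x = t)"
proof -
  have "definable (\<lambda>x. \<forall>a\<in>\<Sigma>. holds R V x a \<longleftrightarrow> a \<in> t)"
    by (intro definable_Ball finite_\<Sigma> definable_eq_const definable_holds)
  from definable_conj[OF definable_const[of "t \<subseteq> \<Sigma>"] this]
  show ?thesis by (rule definable_cong, unfold tp_def) blast
qed

text \<open>Only the finitely many subsets of \<open>\<Sigma>\<close> can be types, so a finite
  conjunction lists which of them occur in the cluster; the constant conjunct deals with a
  \<open>q\<close> having other members.\<close>

lemma definable_qs: "definable (\<lambda>x. qs x = q)"
proof -
  let ?r = "\<lambda>t x. \<exists>y. (x, y) \<in> R Exist \<and> tp y = t"
  have "definable (\<lambda>x. \<forall>t\<in>Pow \<Sigma>. ?r t x \<longleftrightarrow> t \<in> q)"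
    by (intro definable_Ball definable_eq_const definable_Poss definable_tp)
      (simp add: finite_\<Sigma>)
  from definable_conj[OF definable_const[of "q \<subseteq> Pow \<Sigma>"] this]
  show ?thesis
  proof (rule definable_cong)
    fix x
    have qs: "qs x \<subseteq> Pow \<Sigma>" by (auto simp: qs_def tp_def)
    have r: "?r t x \<longleftrightarrow> t \<in> qs x" for t by (auto simp: qs_def)
    show "(q \<subseteq> Pow \<Sigma> \<and> (\<forall>t\<in>Pow \<Sigma>. ?r t x \<longleftrightarrow> t \<in> q)) \<longleftrightarrow> qs x = q"
      unfolding r using qs by blast
  qed
qed

lemma commute_definable:
  assumes "definable P" and "x \<in> W"
  shows "(\<exists>y z. (x, y) \<in> R Exist \<and> (y, z) \<in> R Diamond \<and> P z) \<longleftrightarrow>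
    (\<exists>y z. (x, y) \<in> R Diamond \<and> (y, z) \<in> R Exist \<and> P z)"
proof -
  obtain a where "\<And>z. z \<in> W \<Longrightarrow> holds R V z a \<longleftrightarrow> P z"
    using assms(1) unfolding definable_def by blast
  then have a: "z \<in> W \<and> holds R V z a \<longleftrightarrow> z \<in> W \<and> P z" for z by blast
  have "holds R V x (bEx (bDia a)) \<longleftrightarrow>
      (\<exists>y z. (x, y) \<in> R Exist \<and> (y, z) \<in> R Diamond \<and> z \<in> W \<and> holds R V z a)"
    "holds R V x (bDia (bEx a)) \<longleftrightarrow>
      (\<exists>y z. (x, y) \<in> R Diamond \<and> (y, z) \<in> R Exist \<and> z \<in> W \<and> holds R V z a)"
    unfolding holds.simps using rel_W by blast+
  then show ?thesis using commute[OF assms(2), of a] rel_W unfolding a by blast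
qed

lemma qs_E: "(x, y) \<in> R Exist \<Longrightarrow> qs x = qs y"
  unfolding qs_def using E_sym E_trans by blast

text \<open>Commutation moves a successor to some point of the cluster of a successor of
  \<open>x'\<close>. This loses the type but not the quasi-state, which is constant on
  clusters.\<close>

lemma qs_lift:
  assumes "(x, x') \<in> R Exist" "(x, z) \<in> R Diamond"
  shows "\<exists>z'. (x', z') \<in> R Diamond \<and> qs z' = qs z"
proof -
  have "x' \<in> W" using assms(1) rel_W by blast
  from commute_definable[OF definable_qs this, of "qs z"]
  obtain y z' where "(x', y) \<in> R Diamond" "(y, z') \<in> R Exist" "qs z' = qs z"
    using assms(2) E_sym[OF assms(1)] by blast
  then show ?thesis using qs_E by auto
qed

lemma tp_lower:
  assumes "(x, z) \<in> R Diamond" "t \<in> qs z"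
  shows "\<exists>x' z'. (x, x') \<in> R Exist \<and> (x', z') \<in> R Diamond \<and> tp z' = t"
proof -
  obtain z' where "(z, z') \<in> R Exist" "tp z' = t" using assms(2) by (rule in_qsE)
  moreover have "x \<in> W" using assms(1) rel_W by blast
  ultimately show ?thesis
    unfolding commute_definable[OF definable_tp \<open>x \<in> W\<close>] using assms(1) by blast
qed

lemma reach_E: "(x, y) \<in> R Exist \<Longrightarrow> reach x = reach y"
proof -
  have "reach x \<subseteq> reach y" if xy: "(x, y) \<in> R Exist" for x y
  proof
    fix q assume "q \<in> reach x"
    then obtain z where z: "q = qs z" "z = x \<or> (x, z) \<in> R Diamond" unfolding reach_def by blast
    show "q \<in> reach y"
    proof (cases "z = x")
      case True
      then show ?thesis using z qs_E[OF xy] unfolding reach_def by blast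
    next
      case False
      then obtain z' where "(y, z') \<in> R Diamond" "qs z' = qs z" using z qs_lift[OF xy] by blast
      then show ?thesis using z unfolding reach_def by auto
    qed
  qed
  then show "(x, y) \<in> R Exist \<Longrightarrow> reach x = reach y" using E_sym by blast
qed

lemma reach_Diamond: "(x, y) \<in> R Diamond \<Longrightarrow> reach y \<subseteq> reach x"
  unfolding reach_def using D_trans by blast

lemma finite_reach: "finite (reach x)"
proof (rule finite_subset)
  show "reach x \<subseteq> Pow (Pow \<Sigma>)" by (auto simp: reach_def qs_def tp_def)
qed (simp add: finite_\<Sigma>)

text \<open>This is the relation of the transitive (Lemmon) filtration: the second alternative makes
  it transitive on types.\<close>

definition arrow :: "bfm set \<Rightarrow> bfm set \<Rightarrow> bool" where
  "arrow s t \<longleftrightarrow> (\<forall>a. bDia a \<in> \<Sigma> \<longrightarrow> a \<in> t \<or> bDia a \<in> t \<longrightarrow> bDia a \<in> s)"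

lemma arrow_trans: "arrow s t \<Longrightarrow> arrow t u \<Longrightarrow> arrow s u"
  unfolding arrow_def by blast

lemma arrow_tp: "(x, y) \<in> R Diamond \<Longrightarrow> arrow (tp x) (tp y)"
  unfolding arrow_def tp_def using D_trans by auto

text \<open>Totality and surjectivity of \<open>arrow\<close> between the two quasi-states come from
  opposite halves of commutation. The former continues a run into a subtree, the latter extends a
  run of a subtree down to the root.\<close>

lemma arrow_total:
  assumes "(x, y) \<in> R Diamond" "s \<in> qs x"
  shows "\<exists>t\<in>qs y. arrow s t"
proof -
  obtain x' where x': "(x, x') \<in> R Exist" "tp x' = s" using assms(2) by (rule in_qsE)
  then obtain y' where "(x', y') \<in> R Diamond" "qs y' = qs y" using qs_lift assms(1) by blast
  moreover from this have "arrow s (tp y')" "tp y' \<in> qs y'"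
    using x'(2) arrow_tp tp_in_qs rel_W by blast+
  ultimately show ?thesis by auto
qed

lemma arrow_surj:
  assumes "(x, y) \<in> R Diamond" "t \<in> qs y"
  shows "\<exists>s\<in>qs x. arrow s t"
proof -
  obtain x' y' where "(x, x') \<in> R Exist" "(x', y') \<in> R Diamond" "tp y' = t"
    using tp_lower[OF assms] by blast
  then show ?thesis using arrow_tp unfolding qs_def by blast
qed

end

text \<open>
  A node of a quasi-tree is the sequence of demands leading to it, where the demand \<open>(t, a, b)\<close>
  asks a run of type \<open>t\<close> for a strict successor of type containing \<open>a\<close>. The bit \<open>b\<close> provides two
  copies of every successor: a run that has to miss \<open>a\<close> in one copy can realise it in the other.
\<close>

type_synonym node = "(bfm set \<times> bfm \<times> bool) list"

text \<open>The condition \<open>progress\<close> is what has to be proved separately for the two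
  logics. It offers \<open>x'\<close> in place of \<open>x\<close> because trees remember only type
  and quasi-state; the shrinking of \<open>reach\<close> makes the construction terminate.\<close>

locale progressive_model = comm_model W R V \<Sigma>
  for W :: "'w set" and R V \<Sigma> +
  fixes \<rho> :: bool \<comment> \<open>whether \<open>R Diamond\<close> is reflexive\<close>
  assumes refl_Diamond: "\<rho> \<Longrightarrow> x \<in> W \<Longrightarrow> (x, x) \<in> R Diamond"
    and progress: "\<lbrakk>x \<in> W; bDia a \<in> \<Sigma>; holds R V x (bDia a); \<not> (\<rho> \<and> holds R V x a)\<rbrakk> \<Longrightarrow>
      \<exists>x' y. tp x' = tp x \<and> qs x' = qs x \<and> (x', y) \<in> R Diamond \<and> holds R V y a \<and>
        reach y \<subset> reach x"
begin

definition demand :: "bfm set \<Rightarrow> bfm \<Rightarrow> bool" where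
  "demand t a \<longleftrightarrow> bDia a \<in> \<Sigma> \<and> bDia a \<in> t \<and> \<not> (\<rho> \<and> a \<in> t)"

text \<open>Runs serve as second coordinates. At a node all runs are alternatives for
  \<open>bEx\<close>, so their values there must form exactly a quasi-state. Arrows ensure that a
  witness above a node puts \<open>bDia a\<close> into its type; the last clause supplies
  witnesses.\<close>

definition quasi_tree :: "node set \<Rightarrow> (node \<Rightarrow> bfm set) set \<Rightarrow> bool" where
  "quasi_tree X F \<longleftrightarrow> finite X \<and> [] \<in> X \<and>
    (\<forall>p\<in>X. \<exists>w\<in>W. (\<lambda>r. r p) ` F = qs w) \<and>
    (\<forall>r\<in>F. \<forall>p\<in>X. \<forall>p'\<in>X. strict_prefix p p' \<longrightarrow> arrow (r p) (r p')) \<and>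
    (\<forall>r\<in>F. \<forall>p\<in>X. \<forall>a. demand (r p) a \<longrightarrow> (\<exists>p'\<in>X. strict_prefix p p' \<and> a \<in> r p'))"

lemma quasi_treeD:
  assumes "quasi_tree X F"
  shows quasi_tree_finite: "finite X"
    and quasi_tree_Nil: "[] \<in> X"
    and quasi_tree_qs: "p \<in> X \<Longrightarrow> \<exists>w\<in>W. (\<lambda>r. r p) ` F = qs w"
    and quasi_tree_arrow:
      "r \<in> F \<Longrightarrow> p \<in> X \<Longrightarrow> p' \<in> X \<Longrightarrow> strict_prefix p p' \<Longrightarrow> arrow (r p) (r p')"
    and quasi_tree_demand:
      "r \<in> F \<Longrightarrow> p \<in> X \<Longrightarrow> demand (r p) a \<Longrightarrow> \<exists>p'\<in>X. strict_prefix p p' \<and> a \<in> r p'"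
  using assms unfolding quasi_tree_def by blast+

text \<open>A demand of any type in the quasi-state can be raised by a member of the cluster, and
  \<open>reach\<close> is constant on clusters, so the measure drops relative to \<open>x\<close> as
  well.\<close>

lemma progress_demand:
  assumes "x \<in> W" "t \<in> qs x" "demand t a"
  shows "\<exists>y\<in>W. card (reach y) < card (reach x) \<and> (\<exists>t'\<in>qs y. arrow t t' \<and> a \<in> t') \<and>
    (\<forall>s\<in>qs x. \<exists>s'\<in>qs y. arrow s s') \<and> (\<forall>s'\<in>qs y. \<exists>s\<in>qs x. arrow s s')"
proof -
  obtain z where z: "(x, z) \<in> R Exist" "tp z = t" using assms(2) by (rule in_qsE)
  have a: "bDia a \<in> \<Sigma>" "a \<in> \<Sigma>" "bDia a \<in> tp z" "\<not> (\<rho> \<and> a \<in> tp z)"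
    using assms(3) \<Sigma>_Poss unfolding demand_def z(2) by blast+
  then have "holds R V z (bDia a)" "\<not> (\<rho> \<and> holds R V z a)"
    unfolding tp_def by blast+
  moreover have "z \<in> W" using z(1) rel_W by blast
  ultimately obtain x' y where y: "tp x' = tp z" "qs x' = qs z" "(x', y) \<in> R Diamond"
    "holds R V y a" "reach y \<subset> reach z"
    using progress[OF _ a(1)] by blast
  have x': "tp x' = t" "qs x' = qs x" using y z qs_E by auto
  have "y \<in> W" using y(3) rel_W by blast
  moreover have "card (reach y) < card (reach x)"
    using y(5) reach_E[OF z(1)] psubset_card_mono[OF finite_reach] by simp
  moreover have "\<exists>t'\<in>qs y. arrow t t' \<and> a \<in> t'"
  proof
    show "arrow t (tp y) \<and> a \<in> tp y"
      using arrow_tp[OF y(3)] x'(1) a(2) y(4) by (simp add: tp_def)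
  qed (rule tp_in_qs[OF \<open>y \<in> W\<close>])
  moreover have "\<forall>s\<in>qs x. \<exists>s'\<in>qs y. arrow s s'" "\<forall>s'\<in>qs y. \<exists>s\<in>qs x. arrow s s'"
    using arrow_total[OF y(3)] arrow_surj[OF y(3)] unfolding x'(2) by blast+
  ultimately show ?thesis by blast
qed

lemma quasi_tree_exists: "x \<in> W \<Longrightarrow> \<exists>X F. quasi_tree X F \<and> (\<lambda>r. r []) ` F = qs x"
proof (induction "card (reach x)" arbitrary: x rule: less_induct)
  case less
  let ?q = "qs x"
  define D :: "(bfm set \<times> bfm \<times> bool) set" where
    "D = {(t, a, b) | t a b. t \<in> ?q \<and> demand t a}"
  have D: "(t, a, b) \<in> D \<longleftrightarrow> t \<in> ?q \<and> demand t a" for t a b by (simp add: D_def)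
  have "D \<subseteq> Pow \<Sigma> \<times> \<Sigma> \<times> UNIV"
    using \<Sigma>_Poss by (auto simp: D_def qs_def tp_def demand_def)
  then have finite_D: "finite D" by (rule finite_subset) (simp add: finite_\<Sigma>)
  define step where "step d X F \<longleftrightarrow> quasi_tree X F \<and>
      (\<exists>r\<in>F. arrow (fst d) (r []) \<and> fst (snd d) \<in> r []) \<and>
      (\<forall>s\<in>?q. \<exists>r\<in>F. arrow s (r [])) \<and> (\<forall>r\<in>F. \<exists>s\<in>?q. arrow s (r []))"
    for d :: "bfm set \<times> bfm \<times> bool" and X F
  have "\<exists>X F. step d X F" if "d \<in> D" for d
  proof -
    obtain t a b where d: "d = (t, a, b)" by (cases d)
    then have "t \<in> ?q" "demand t a" using that D by auto
    from progress_demand[OF less.prems this]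
    obtain y where y: "y \<in> W" "card (reach y) < card (reach x)"
      "(\<exists>t'\<in>qs y. arrow t t' \<and> a \<in> t') \<and>
        (\<forall>s\<in>?q. \<exists>s'\<in>qs y. arrow s s') \<and> (\<forall>s'\<in>qs y. \<exists>s\<in>?q. arrow s s')" by blast
    obtain X F where XF: "quasi_tree X F" "(\<lambda>r. r []) ` F = qs y"
      using less.hyps[OF y(2,1)] by blast
    have "step d X F"
      using XF(1) y(3) unfolding step_def d XF(2)[symmetric] by simp
    then show ?thesis by blast
  qed
  then obtain X F where XF: "\<And>d. d \<in> D \<Longrightarrow> step d (X d) (F d)" by metis
  have sub: "quasi_tree (X d) (F d)"
    and wit: "\<exists>r\<in>F d. arrow (fst d) (r []) \<and> fst (snd d) \<in> r []"
    and total: "\<And>s. s \<in> ?q \<Longrightarrow> \<exists>r\<in>F d. arrow s (r [])"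
    and surj: "\<And>r. r \<in> F d \<Longrightarrow> \<exists>s\<in>?q. arrow s (r [])" if "d \<in> D" for d
    using XF[OF that] unfolding step_def by simp_all
  define Y where "Y = insert [] (\<Union>d\<in>D. (#) d ` X d)"
  \<comment> \<open>These are all the functions glued from runs of the subtrees along arrows,
    provided that each demand of the root type is served in one of its two copies.\<close>
  define G where "G = {r. r [] \<in> ?q \<and> (\<forall>d\<in>D. (\<lambda>p. r (d # p)) \<in> F d \<and> arrow (r []) (r [d])) \<and>
    (\<forall>a. demand (r []) a \<longrightarrow> (\<exists>b. a \<in> r [(r [], a, b)]))}"
  have Y_Cons: "d # p \<in> Y \<longleftrightarrow> d \<in> D \<and> p \<in> X d" for d p by (auto simp: Y_def)
  have Y_Nil: "[] \<in> Y" by (simp add: Y_def)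
  have X_Nil: "[] \<in> X d" if "d \<in> D" for d by (rule quasi_tree_Nil[OF sub[OF that]])
  \<comment> \<open>Prescribing the root type and the run in one child is enough for both needs:
    every root type occurs, and every run of a subtree survives in the whole tree.\<close>
  have extend: "\<exists>r\<in>G. r [] = s \<and> (\<forall>d\<in>D. d = d\<^sub>0 \<longrightarrow> (\<lambda>p. r (d # p)) = r\<^sub>0)"
    if s: "s \<in> ?q" and r\<^sub>0: "d\<^sub>0 \<in> D \<Longrightarrow> r\<^sub>0 \<in> F d\<^sub>0 \<and> arrow s (r\<^sub>0 [])" for s d\<^sub>0 r\<^sub>0
  proof -
    \<comment> \<open>Children without a prescribed run serve their demand immediately whenever it
      is a demand of \<open>s\<close>.\<close>
    define pick where
      "pick d r \<longleftrightarrow> r \<in> F d \<and> arrow s (r []) \<and> (s = fst d \<longrightarrow> fst (snd d) \<in> r [])" for d r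
    have "\<exists>r. pick d r" if d: "d \<in> D" for d
    proof (cases "s = fst d")
      case True
      then show ?thesis using wit[OF d] unfolding pick_def by blast
    next
      case False
      then show ?thesis using total[OF d s] unfolding pick_def by blast
    qed
    then obtain g where pick: "\<And>d. d \<in> D \<Longrightarrow> pick d (g d)" by metis
    have g: "g d \<in> F d" "arrow s (g d [])" "s = fst d \<Longrightarrow> fst (snd d) \<in> g d []" if "d \<in> D" for d
      using pick[OF that] unfolding pick_def by simp_all
    define r where
      "r p = (case p of [] \<Rightarrow> s | d # p' \<Rightarrow> if d = d\<^sub>0 then r\<^sub>0 p' else g d p')" for p
    have "\<exists>b. a \<in> r [(s, a, b)]" if a: "demand s a" for a
    proof -
      \<comment> \<open>The copies differ in \<open>b\<close>, so one of them is not the prescribed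
        child and its run is chosen by \<open>g\<close>.\<close>
      obtain b where "(s, a, b) \<noteq> d\<^sub>0" by (cases d\<^sub>0) blast
      moreover have "a \<in> g (s, a, b) []" using g(3)[of "(s, a, b)"] D s a by simp
      ultimately have "a \<in> r [(s, a, b)]" by (simp add: r_def)
      then show ?thesis ..
    qed
    then have "r \<in> G" using s r\<^sub>0 g(1,2) by (auto simp: G_def r_def)
    then show ?thesis by (intro bexI[of _ r]) (auto simp: r_def)
  qed
  have G_child: "(\<lambda>p. r (d # p)) \<in> F d" if "r \<in> G" "d \<in> D" for r d
    using that by (simp add: G_def)
  have G_root: "(\<lambda>r. r []) ` G = ?q"
  proof
    show "(\<lambda>r. r []) ` G \<subseteq> ?q" by (auto simp: G_def)
    show "?q \<subseteq> (\<lambda>r. r []) ` G"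
    proof
      fix s assume s: "s \<in> ?q"
      \<comment> \<open>An arbitrary label, since only the root type matters here: outside
        \<open>D\<close> the prescription is vacuous, inside \<open>D\<close> it is met by
        totality.\<close>
      define d\<^sub>0 where "d\<^sub>0 = (s, Bot :: bfm, True)"
      have "\<exists>r\<^sub>0. d\<^sub>0 \<in> D \<longrightarrow> r\<^sub>0 \<in> F d\<^sub>0 \<and> arrow s (r\<^sub>0 [])"
        using total[OF _ s, of d\<^sub>0] by blast
      then obtain r\<^sub>0 where "d\<^sub>0 \<in> D \<longrightarrow> r\<^sub>0 \<in> F d\<^sub>0 \<and> arrow s (r\<^sub>0 [])" by blast
      then show "s \<in> (\<lambda>r. r []) ` G" using extend[OF s, of d\<^sub>0 r\<^sub>0] by blast
    qed
  qed
  have G_sub: "(\<lambda>r. \<lambda>p. r (d # p)) ` G = F d" if d: "d \<in> D" for d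
  proof
    show "(\<lambda>r. \<lambda>p. r (d # p)) ` G \<subseteq> F d" using d by (auto simp: G_def)
    show "F d \<subseteq> (\<lambda>r. \<lambda>p. r (d # p)) ` G"
    proof
      fix r\<^sub>0 assume r\<^sub>0: "r\<^sub>0 \<in> F d"
      then obtain s where "s \<in> ?q" "arrow s (r\<^sub>0 [])" using surj[OF d] by blast
      then obtain r where "r \<in> G" "(\<lambda>p. r (d # p)) = r\<^sub>0" using extend[of s d r\<^sub>0] r\<^sub>0 d by blast
      then show "r\<^sub>0 \<in> (\<lambda>r. \<lambda>p. r (d # p)) ` G" by blast
    qed
  qed
  have "quasi_tree Y G"
    unfolding quasi_tree_def
  proof (intro conjI ballI allI impI)
    have "finite (X d)" if "d \<in> D" for d by (rule quasi_tree_finite[OF sub[OF that]])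
    then show "finite Y" using finite_D by (simp add: Y_def)
    show "[] \<in> Y" by (rule Y_Nil)
  next
    fix p assume p: "p \<in> Y"
    show "\<exists>w\<in>W. (\<lambda>r. r p) ` G = qs w"
    proof (cases p)
      case Nil
      then show ?thesis using G_root less.prems by blast
    next
      case (Cons d p')
      then have d: "d \<in> D" "p' \<in> X d" using p Y_Cons by auto
      have "(\<lambda>r. r p) ` G = (\<lambda>r. r p') ` F d"
        unfolding G_sub[OF d(1), symmetric] Cons by (simp add: image_image)
      then show ?thesis using quasi_tree_qs[OF sub[OF d(1)] d(2)] by simp
    qed
  next
    fix r p p' assume r: "r \<in> G" and p: "p \<in> Y" "p' \<in> Y" "strict_prefix p p'"
    then obtain d p'' where p': "p' = d # p''" by (cases p') auto
    then have d: "d \<in> D" "p'' \<in> X d" using p Y_Cons by auto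
    have sub_d: "arrow (r (d # u)) (r (d # v))"
      if "u \<in> X d" "v \<in> X d" "strict_prefix u v" for u v
      using quasi_tree_arrow[OF sub[OF d(1)] G_child[OF r d(1)]] that .
    show "arrow (r p) (r p')"
    proof (cases p)
      case Nil
      have "arrow (r []) (r [d])" using r d by (simp add: G_def)
      then show ?thesis
        using sub_d[OF X_Nil[OF d(1)] d(2)] arrow_trans Nil p' by (cases p'') auto
    next
      case (Cons e u)
      then show ?thesis using p p' sub_d Y_Cons by (auto simp: strict_prefix_def)
    qed
  next
    fix r p a assume r: "r \<in> G" and p: "p \<in> Y" and a: "demand (r p) a"
    show "\<exists>p'\<in>Y. strict_prefix p p' \<and> a \<in> r p'"
    proof (cases p)
      case Nil
      then obtain b where b: "a \<in> r [(r [], a, b)]" using r a by (auto simp: G_def)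
      have "(r [], a, b) \<in> D" using r a Nil D by (simp add: G_def)
      then have "[(r [], a, b)] \<in> Y" using Y_Cons X_Nil by blast
      then show ?thesis using b Nil by (intro bexI[of _ "[(r [], a, b)]"]) auto
    next
      case (Cons d u)
      then have d: "d \<in> D" "u \<in> X d" using p Y_Cons by auto
      obtain v where "v \<in> X d" "strict_prefix u v" "a \<in> r (d # v)"
        using quasi_tree_demand[OF sub[OF d(1)] G_child[OF r d(1)] d(2)] a Cons by blast
      then show ?thesis using Y_Cons d Cons by (intro bexI[of _ "d # v"]) auto
    qed
  qed
  then show ?case using G_root by blast
qed

text \<open>Runs are arbitrary outside \<open>X\<close>, so there may be infinitely many. Cut off at
  \<open>X\<close>, they map a finite set to subsets of \<open>\<Sigma>\<close> and are finite in
  number.\<close>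

lemma quasi_tree_restrict:
  assumes "quasi_tree X F"
  shows "quasi_tree X ((\<lambda>r. restrict r X) ` F)" "finite ((\<lambda>r. restrict r X) ` F)"
proof -
  have "(\<lambda>r. r p) ` (\<lambda>r. restrict r X) ` F = (\<lambda>r. r p) ` F" if "p \<in> X" for p
    using that by (simp add: image_image)
  then have "quasi_tree X ((\<lambda>r. restrict r X) ` F) \<longleftrightarrow> quasi_tree X F"
    unfolding quasi_tree_def by simp
  then show "quasi_tree X ((\<lambda>r. restrict r X) ` F)" using assms by simp
  have "(\<lambda>r. restrict r X) ` F \<subseteq> X \<rightarrow>\<^sub>E Pow \<Sigma>"
  proof clarify
    fix r assume r: "r \<in> F"
    have "r p \<subseteq> \<Sigma>" if p: "p \<in> X" for p
    proof -
      obtain w where "(\<lambda>r. r p) ` F = qs w" using quasi_tree_qs[OF assms p] by blast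
      then have "r p \<in> qs w" using r by blast
      then show ?thesis by (auto simp: qs_def tp_def)
    qed
    then show "restrict r X \<in> X \<rightarrow>\<^sub>E Pow \<Sigma>" by auto
  qed
  moreover have "finite X" by (rule quasi_tree_finite[OF assms])
  ultimately show "finite ((\<lambda>r. restrict r X) ` F)"
    by (meson finite_PiE finite_Pow_iff finite_\<Sigma> finite_subset)
qed

text \<open>Each value \<open>r p\<close> is the type of a point whose quasi-state is the set of
  values of all runs at \<open>p\<close>; this settles the Boolean and \<open>bEx\<close> cases. The
  injections \<open>f\<close> and \<open>g\<close> carry nodes and runs into the prescribed types of
  points.\<close>

lemma quasi_tree_truth:
  assumes Q: "quasi_tree X F" and f: "inj_on f X" and g: "inj_on g F"
    and "p \<in> X" "r \<in> F" "a \<in> \<Sigma>"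
  defines "T \<equiv> {(f p, f p') | p p'. p \<in> X \<and> p' \<in> X \<and> (strict_prefix p p' \<or> \<rho> \<and> p = p')}"
  defines "U \<equiv> \<lambda>n. {(f p, g r) | p r. p \<in> X \<and> r \<in> F \<and> Atom n \<in> r p}"
  shows "holds (prod_rel (f ` X) T (g ` F) (g ` F \<times> g ` F)) U (f p, g r) a \<longleftrightarrow> a \<in> r p"
proof -
  let ?R = "prod_rel (f ` X) T (g ` F) (g ` F \<times> g ` F)"
  have U: "(f p, g r) \<in> U n \<longleftrightarrow> Atom n \<in> r p" if "p \<in> X" "r \<in> F" for p r n
  proof
    assume "(f p, g r) \<in> U n"
    then obtain p' r' where "f p = f p'" "g r = g r'" "p' \<in> X" "r' \<in> F" "Atom n \<in> r' p'"
      unfolding U_def by blast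
    then show "Atom n \<in> r p" using inj_onD[OF f] inj_onD[OF g] that by blast
  qed (use that in \<open>auto simp: U_def\<close>)
  have T: "(f p, y) \<in> T \<longleftrightarrow> (\<exists>p'\<in>X. y = f p' \<and> (strict_prefix p p' \<or> \<rho> \<and> p = p'))"
    if p: "p \<in> X" for p y
  proof
    assume "(f p, y) \<in> T"
    then obtain q p' where "f p = f q" "y = f p'" "q \<in> X" "p' \<in> X" "strict_prefix q p' \<or> \<rho> \<and> q = p'"
      unfolding T_def by blast
    moreover from this have "p = q" using inj_onD[OF f] p by blast
    ultimately show "\<exists>p'\<in>X. y = f p' \<and> (strict_prefix p p' \<or> \<rho> \<and> p = p')" by blast
  qed (use p in \<open>auto simp: T_def\<close>)
  have Dia: "holds ?R U (f p, g r) (bDia a) \<longleftrightarrow>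
      (\<exists>p'\<in>X. (strict_prefix p p' \<or> \<rho> \<and> p = p') \<and> holds ?R U (f p', g r) a)"
    if "p \<in> X" "r \<in> F" for p r a
  proof -
    have "((f p, g r), y) \<in> ?R Diamond \<longleftrightarrow> (\<exists>x. (f p, x) \<in> T \<and> y = (x, g r))" for y
      using that(2) by (cases y) (auto simp: prod_rel_def)
    then show ?thesis unfolding holds.simps(4) by (simp only: T[OF that(1)]) blast
  qed
  have Ex: "holds ?R U (f p, g r) (bEx a) \<longleftrightarrow> (\<exists>r'\<in>F. holds ?R U (f p, g r') a)"
    if "p \<in> X" "r \<in> F" for p r a
  proof -
    have "((f p, g r), y) \<in> ?R Exist \<longleftrightarrow> (\<exists>r'\<in>F. y = (f p, g r'))" for y
      using that by (cases y) (auto simp: prod_rel_def)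
    then show ?thesis unfolding holds.simps(4) by (simp only:) blast
  qed
  show ?thesis
    using \<open>p \<in> X\<close> \<open>r \<in> F\<close> \<open>a \<in> \<Sigma>\<close>
  proof (induction a arbitrary: p r)
    case (Atom n)
    then show ?case using U by simp
  next
    case Bot
    obtain w where "w \<in> W" "(\<lambda>r. r p) ` F = qs w" using quasi_tree_qs[OF Q Bot(1)] by blast
    then have "r p \<in> qs w" using Bot by blast
    then show ?case by (auto simp: qs_def tp_def)
  next
    case (Imp a b)
    obtain w where "w \<in> W" "(\<lambda>r. r p) ` F = qs w" using quasi_tree_qs[OF Q Imp.prems(1)] by blast
    then have "r p \<in> qs w" using Imp.prems(2) by blast
    then obtain v where v: "tp v = r p" by (rule in_qsE)
    have ab: "a \<in> \<Sigma>" "b \<in> \<Sigma>" using Imp.prems(3) \<Sigma>_Imp by blast+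
    have "(a \<rightarrow>\<^sub>m b) \<in> r p \<longleftrightarrow> (a \<in> r p \<longrightarrow> b \<in> r p)"
      unfolding v[symmetric] tp_def using Imp.prems(3) ab by simp
    then show ?case
      using Imp.IH(1)[OF Imp.prems(1,2) ab(1)] Imp.IH(2)[OF Imp.prems(1,2) ab(2)] by simp
  next
    case (Poss m a)
    have a: "a \<in> \<Sigma>" using Poss.prems \<Sigma>_Poss by blast
    obtain w where w: "w \<in> W" "(\<lambda>r. r p) ` F = qs w"
      using quasi_tree_qs[OF Q Poss.prems(1)] by blast
    then have "r p \<in> qs w" using Poss.prems by blast
    then obtain v where v: "(w, v) \<in> R Exist" "tp v = r p" by (rule in_qsE)
    show ?case
    proof (cases m)
      case Diamond
      have "holds ?R U (f p, g r) (bDia a) \<longleftrightarrow>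
          (\<exists>p'\<in>X. (strict_prefix p p' \<or> \<rho> \<and> p = p') \<and> holds ?R U (f p', g r) a)"
        by (rule Dia[OF Poss.prems(1,2)])
      also have "\<dots> \<longleftrightarrow> (\<exists>p'\<in>X. (strict_prefix p p' \<or> \<rho> \<and> p = p') \<and> a \<in> r p')"
        using Poss.IH Poss.prems a by blast
      also have "\<dots> \<longleftrightarrow> bDia a \<in> r p"
      proof
        assume "\<exists>p'\<in>X. (strict_prefix p p' \<or> \<rho> \<and> p = p') \<and> a \<in> r p'"
        then obtain p' where p': "p' \<in> X" "strict_prefix p p' \<or> \<rho> \<and> p = p'" "a \<in> r p'" by blast
        show "bDia a \<in> r p"
        proof (cases "strict_prefix p p'")
          case True
          then have "arrow (r p) (r p')" using quasi_tree_arrow[OF Q Poss.prems(2,1)] p' by blast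
          then show ?thesis using p' Poss.prems Diamond by (simp add: arrow_def)
        next
          case False
          \<comment> \<open>Here \<open>p' = p\<close>, so reflexivity of the model makes
            \<open>v\<close> its own witness.\<close>
          then have "\<rho>" "holds R V v a" using p' v by (auto simp: tp_def)
          moreover have "v \<in> W" using v(1) rel_W by blast
          ultimately have "holds R V v (bDia a)" using refl_Diamond unfolding holds.simps by blast
          then show ?thesis
            unfolding v(2)[symmetric] tp_def using Poss.prems(3) Diamond by blast
        qed
      next
        assume "bDia a \<in> r p"
        then have "demand (r p) a \<or> \<rho> \<and> a \<in> r p"
          using Poss.prems Diamond by (auto simp: demand_def)
        then show "\<exists>p'\<in>X. (strict_prefix p p' \<or> \<rho> \<and> p = p') \<and> a \<in> r p'"
          using quasi_tree_demand[OF Q Poss.prems(2,1)] Poss.prems(1) by blast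
      qed
      finally show ?thesis using Diamond by simp
    next
      case Exist
      have "holds ?R U (f p, g r) (bEx a) \<longleftrightarrow> (\<exists>r'\<in>F. holds ?R U (f p, g r') a)"
        by (rule Ex[OF Poss.prems(1,2)])
      also have "\<dots> \<longleftrightarrow> (\<exists>r'\<in>F. a \<in> r' p)"
        using Poss.IH Poss.prems a by blast
      also have "\<dots> \<longleftrightarrow> (\<exists>t\<in>qs w. a \<in> t)" using w(2) by blast
      also have "\<dots> \<longleftrightarrow> (\<exists>y. (v, y) \<in> R Exist \<and> a \<in> tp y)"
        unfolding qs_E[OF v(1)] by (auto simp: qs_def)
      also have "\<dots> \<longleftrightarrow> holds R V v (bEx a)" using a by (simp add: tp_def)
      also have "\<dots> \<longleftrightarrow> bEx a \<in> r p"
        unfolding v(2)[symmetric] tp_def using Poss.prems(3) Exist by blast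
      finally show ?thesis using Exist by simp
    qed
  qed
qed

end

lemma finite_imp_inj_on:
  assumes "finite A" "infinite (UNIV :: 'b set)"
  shows "\<exists>f :: 'a \<Rightarrow> 'b. inj_on f A"
proof -
  obtain B :: "'b set" where "finite B" "card B = card A"
    using infinite_arbitrarily_large[OF assms(2)] by blast
  then show ?thesis using finite_same_card_bij[OF assms(1)] bij_betw_def by metis
qed

text \<open>Finiteness of the tree is used twice: to embed it into a given infinite type, and to
  obtain converse well-foundedness from acyclicity.\<close>

lemma (in progressive_model) product_countermodel:
  assumes "infinite (UNIV :: 'a set)" "infinite (UNIV :: 'b set)"
    and w: "w \<in> W" "a \<in> \<Sigma>" "\<not> holds R V w a"
  shows "\<exists>(X\<^sub>1 :: 'a set) R\<^sub>1 (X\<^sub>2 :: 'b set). R\<^sub>1 \<subseteq> X\<^sub>1 \<times> X\<^sub>1 \<and> trans R\<^sub>1 \<and> wf ((R\<^sub>1 - Id)\<inverse>) \<and>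
    (if \<rho> then refl_on X\<^sub>1 R\<^sub>1 else irrefl R\<^sub>1) \<and>
    \<not> valid (X\<^sub>1 \<times> X\<^sub>2) (prod_rel X\<^sub>1 R\<^sub>1 X\<^sub>2 (X\<^sub>2 \<times> X\<^sub>2)) a"
proof -
  obtain X F\<^sub>0 where Q\<^sub>0: "quasi_tree X F\<^sub>0" "(\<lambda>r. r []) ` F\<^sub>0 = qs w"
    using quasi_tree_exists[OF w(1)] by blast
  define F where "F = (\<lambda>r. restrict r X) ` F\<^sub>0"
  have Q: "quasi_tree X F" "finite F" unfolding F_def by (intro quasi_tree_restrict Q\<^sub>0)+
  have X: "finite X" "[] \<in> X" using Q(1) by (auto simp: quasi_tree_def)
  have "(\<lambda>r. r []) ` F = qs w" using Q\<^sub>0(2) X(2) unfolding F_def by (simp add: image_image)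
  moreover have "tp w \<in> qs w" using w tp_in_qs by blast
  ultimately have "tp w \<in> (\<lambda>r. r []) ` F" by simp
  then obtain r where r: "tp w = r []" "r \<in> F" by (rule imageE)
  obtain f :: "node \<Rightarrow> 'a" where f: "inj_on f X" using finite_imp_inj_on[OF X(1) assms(1)] by blast
  obtain g :: "(node \<Rightarrow> bfm set) \<Rightarrow> 'b" where g: "inj_on g F"
    using finite_imp_inj_on[OF Q(2) assms(2)] by blast
  define T where "T = {(f p, f p') | p p'. p \<in> X \<and> p' \<in> X \<and> (strict_prefix p p' \<or> \<rho> \<and> p = p')}"
  define U where "U n = {(f p, g r) | p r. p \<in> X \<and> r \<in> F \<and> Atom n \<in> r p}" for n
  have "\<not> holds (prod_rel (f ` X) T (g ` F) (g ` F \<times> g ` F)) U (f [], g r) a"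
    using quasi_tree_truth[OF Q(1) f g X(2) r(2) w(2)] w(3) r(1)[symmetric]
    unfolding T_def U_def by (simp add: tp_def)
  moreover have "\<forall>n. U n \<subseteq> f ` X \<times> g ` F" by (auto simp: U_def)
  moreover have "(f [], g r) \<in> f ` X \<times> g ` F" using X(2) r(2) by blast
  ultimately have nv: "\<not> valid (f ` X \<times> g ` F) (prod_rel (f ` X) T (g ` F) (g ` F \<times> g ` F)) a"
    unfolding valid_def by blast
  have sub: "T \<subseteq> f ` X \<times> f ` X" by (auto simp: T_def)
  have T_iff: "(f p, f p') \<in> T \<longleftrightarrow> strict_prefix p p' \<or> \<rho> \<and> p = p'" if "p \<in> X" "p' \<in> X" for p p'
  proof
    assume "(f p, f p') \<in> T"
    then obtain u v where "f p = f u" "f p' = f v" "u \<in> X" "v \<in> X" "strict_prefix u v \<or> \<rho> \<and> u = v"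
      unfolding T_def by blast
    moreover from this have "p = u" "p' = v" using inj_onD[OF f] that by blast+
    ultimately show "strict_prefix p p' \<or> \<rho> \<and> p = p'" by blast
  qed (use that in \<open>auto simp: T_def\<close>)
  have tr: "trans T"
  proof (rule transI)
    fix x y z assume xyz: "(x, y) \<in> T" "(y, z) \<in> T"
    then obtain p p' p'' where p: "x = f p" "y = f p'" "z = f p''" "p \<in> X" "p' \<in> X" "p'' \<in> X"
      using sub by blast
    then have "strict_prefix p p' \<or> \<rho> \<and> p = p'" "strict_prefix p' p'' \<or> \<rho> \<and> p' = p''"
      using xyz T_iff by auto
    then have "strict_prefix p p'' \<or> \<rho> \<and> p = p''" using prefix_order.less_trans by blast
    then show "(x, z) \<in> T" using p T_iff by blast
  qed
  have irr: "irrefl (T - Id)" by (auto simp: irrefl_def)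
  have "trans (T - Id)"
  proof (rule transI)
    fix x y z assume xyz: "(x, y) \<in> T - Id" "(y, z) \<in> T - Id"
    then obtain p p' p'' where p: "x = f p" "y = f p'" "z = f p''" "p \<in> X" "p' \<in> X" "p'' \<in> X"
      using sub by blast
    then have "strict_prefix p p'" "strict_prefix p' p''" using xyz T_iff by auto
    then have "strict_prefix p p''" by (rule prefix_order.less_trans)
    moreover from this have "p \<noteq> p''" by auto
    ultimately show "(x, z) \<in> T - Id" using p T_iff inj_onD[OF f] by blast
  qed
  then have "acyclic (T - Id)" using irr by (simp add: acyclic_irrefl trancl_id)
  moreover have "finite (T - Id)"
    by (rule finite_subset[of _ "f ` X \<times> f ` X"]) (use sub X(1) in auto)
  ultimately have "wf ((T - Id)\<inverse>)" by (rule finite_acyclic_wf_converse[rotated])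
  moreover have "if \<rho> then refl_on (f ` X) T else irrefl T"
    using T_iff sub by (auto simp: refl_on_def irrefl_def)
  ultimately show ?thesis using sub tr nv by blast
qed

section \<open>Progress\<close>

lemma (in comm_model) progressive_GL:
  assumes loeb: "\<And>x a. x \<in> W \<Longrightarrow> holds R V x (bBox (bBox a \<rightarrow>\<^sub>m a) \<rightarrow>\<^sub>m bBox a)"
  shows "progressive_model W R V \<Sigma> False"
proof
  fix x a
  assume x: "x \<in> W" "bDia a \<in> \<Sigma>" "holds R V x (bDia a)"
  \<comment> \<open>Loeb's axiom for \<open>Neg b\<close>, contraposed: a definable property that
    holds somewhere ahead holds there for a last time.\<close>
  have last: "\<exists>z. (x, z) \<in> R Diamond \<and> P z \<and> (\<forall>u. (z, u) \<in> R Diamond \<longrightarrow> \<not> P u)"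
    if P: "definable P" and y: "(x, y) \<in> R Diamond" "P y" for P y
  proof -
    obtain b where b: "\<And>z. z \<in> W \<Longrightarrow> holds R V z b \<longleftrightarrow> P z" using P unfolding definable_def by blast
    have "y \<in> W" using y rel_W by blast
    then have "\<not> holds R V x (bBox (Neg b))" using y b unfolding holds_Nec holds_Neg by blast
    then have "\<not> holds R V x (bBox (bBox (Neg b) \<rightarrow>\<^sub>m Neg b))"
      using loeb[OF x(1), of "Neg b"] unfolding holds.simps(3)[of _ _ x] by blast
    then obtain z where z: "(x, z) \<in> R Diamond" "holds R V z b"
      "\<forall>u. (z, u) \<in> R Diamond \<longrightarrow> \<not> holds R V u b"
      unfolding holds_Nec holds.simps(3) holds_Neg by blast
    then show ?thesis using b rel_W by blast
  qed
  \<comment> \<open>Since \<open>last\<close> only finds successors, \<open>x\<close> itself is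
    taken if its quasi-state does not recur.\<close>
  obtain x1 where x1: "x1 = x \<or> (x, x1) \<in> R Diamond" "qs x1 = qs x"
    "\<And>u. (x1, u) \<in> R Diamond \<Longrightarrow> qs u \<noteq> qs x"
  proof (cases "\<exists>u. (x, u) \<in> R Diamond \<and> qs u = qs x")
    case True
    then show ?thesis using last[OF definable_qs[of "qs x"]] that by blast
  next
    case False
    then show ?thesis using that[of x] by blast
  qed
  \<comment> \<open>The last point may have another type, but its cluster contains a point
    \<open>x'\<close> with the type of \<open>x\<close>, which raises the same demand.\<close>
  have "tp x \<in> qs x1" using tp_in_qs[OF x(1)] x1(2) by simp
  then obtain x' where x': "(x1, x') \<in> R Exist" "tp x' = tp x" by (rule in_qsE)
  have "bDia a \<in> tp x" using x by (simp add: tp_def)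
  then have "bDia a \<in> tp x'" using x'(2) by simp
  then obtain y where y: "(x', y) \<in> R Diamond" "holds R V y a" by (auto simp: tp_def)
  have "reach y \<subseteq> reach x"
    using reach_Diamond[OF y(1)] reach_E[OF x'(1)] reach_Diamond[of x x1] x1(1) by auto
  moreover have "qs x \<in> reach x" by (auto simp: reach_def)
  moreover have "qs x \<notin> reach y"
  proof
    assume "qs x \<in> reach y"
    then obtain z where "qs z = qs x" "z = y \<or> (y, z) \<in> R Diamond" by (auto simp: reach_def)
    then have "(x', z) \<in> R Diamond" using y(1) D_trans by blast
    then obtain z' where "(x1, z') \<in> R Diamond" "qs z' = qs z"
      using qs_lift[OF E_sym[OF x'(1)]] by blast
    then show False using x1(3) \<open>qs z = qs x\<close> by auto
  qed
  ultimately have "reach y \<subset> reach x" by blast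
  moreover have "qs x' = qs x" using qs_E[OF x'(1)] x1(2) by simp
  ultimately show "\<exists>x' y. tp x' = tp x \<and> qs x' = qs x \<and> (x', y) \<in> R Diamond \<and> holds R V y a \<and>
      reach y \<subset> reach x"
    using x'(2) y by blast
qed blast

text \<open>
  The axiom of \<open>MplusGrzB\<close> supplies a cluster whose points can see the type \<open>t\<close> within the
  quasi-state \<open>q\<close> for as long as any point of the cluster can see \<open>q\<close>. Hence a point that has left
  \<open>t\<close> within \<open>q\<close> for good no longer sees \<open>q\<close> at all.
\<close>

lemma (in comm_model) progressive_Grz:
  assumes refl: "\<And>x. x \<in> W \<Longrightarrow> (x, x) \<in> R Diamond"
    and grz: "\<And>x a. x \<in> W \<Longrightarrow> holds R V x (bBox (bBox (a \<rightarrow>\<^sub>m bBox a) \<rightarrow>\<^sub>m a) \<rightarrow>\<^sub>m a)"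
    and mplus: "\<And>x a. x \<in> W \<Longrightarrow> holds R V x
      (bBox (bAll (bBox (bBox a \<rightarrow>\<^sub>m bBox (bAll a)) \<rightarrow>\<^sub>m bBox (bAll a))) \<rightarrow>\<^sub>m bBox (bAll a))"
  shows "progressive_model W R V \<Sigma> True"
proof
  fix x a
  assume x: "x \<in> W" "bDia a \<in> \<Sigma>" "holds R V x (bDia a)" "\<not> (True \<and> holds R V x a)"
  \<comment> \<open>Fixing type and quasi-state together makes maximality speak about points that
    still raise the demand.\<close>
  define P where "P z \<longleftrightarrow> tp z = tp x \<and> qs z = qs x" for z
  have "definable P"
    unfolding P_def by (intro definable_conj definable_tp definable_qs)
  then obtain b where b: "\<And>z. z \<in> W \<Longrightarrow> holds R V z b \<longleftrightarrow> P z" unfolding definable_def by blast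
  have Px: "holds R V x b" using b[OF x(1)] by (simp add: P_def)
  have "\<not> holds R V x (bBox (bAll (Neg b)))"
    using Px refl[OF x(1)] E_refl[OF x(1)] unfolding holds_Nec holds_Neg by blast
  then have "\<not> holds R V x (bBox (bAll (bBox (bBox (Neg b) \<rightarrow>\<^sub>m bBox (bAll (Neg b)))
      \<rightarrow>\<^sub>m bBox (bAll (Neg b)))))"
    using mplus[OF x(1), of "Neg b"] unfolding holds.simps(3)[of _ _ x] by blast
  then obtain x0 x1 where x1: "(x, x0) \<in> R Diamond" "(x0, x1) \<in> R Exist"
    "\<not> holds R V x1 (bBox (bAll (Neg b)))"
    "holds R V x1 (bBox (bBox (Neg b) \<rightarrow>\<^sub>m bBox (bAll (Neg b))))"
    unfolding holds_Nec[of _ _ x] holds_Nec[of _ _ _ Exist] holds.simps(3) by blast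
  have x1W: "x1 \<in> W" using x1 rel_W by blast
  \<comment> \<open>Beyond \<open>x1\<close>, a point with some \<open>b\<close> in the cluster of a
    successor sees \<open>b\<close> itself. This ties the single point to its whole cluster.\<close>
  have later: "\<not> holds R V y (bBox (bAll (Neg b))) \<Longrightarrow> \<not> holds R V y (bBox (Neg b))"
    if "(x1, y) \<in> R Diamond" for y
    using x1(4) that unfolding holds_Nec[of _ _ x1] holds.simps(3) by blast
  have "\<not> holds R V x1 (bBox (Neg b))" by (rule later[OF refl[OF x1W] x1(3)])
  then obtain x2 where x2: "(x1, x2) \<in> R Diamond" "holds R V x2 b"
    unfolding holds_Nec holds_Neg by blast
  have "x2 \<in> W" using x2 rel_W by blast
  then have "\<not> holds R V x2 (bBox (bBox (Neg b \<rightarrow>\<^sub>m bBox (Neg b)) \<rightarrow>\<^sub>m Neg b))"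
    using grz[of x2 "Neg b"] x2(2) unfolding holds.simps(3)[of _ _ x2] holds_Neg by blast
  then obtain x' where x': "(x2, x') \<in> R Diamond" "holds R V x' b"
    "holds R V x' (bBox (Neg b \<rightarrow>\<^sub>m bBox (Neg b)))"
    unfolding holds_Nec[of _ _ x2] holds.simps(3) holds_Neg by blast
  have "x' \<in> W" using x' rel_W by blast
  then have Px': "tp x' = tp x" "qs x' = qs x" using b x'(2) by (auto simp: P_def)
  have "bDia a \<in> tp x" using x by (simp add: tp_def)
  then have "bDia a \<in> tp x'" using Px' by simp
  then obtain y where y: "(x', y) \<in> R Diamond" "holds R V y a" by (auto simp: tp_def)
  have yW: "y \<in> W" using y rel_W by blast
  \<comment> \<open>The unserved demand separates the types of \<open>x\<close> and
    \<open>y\<close>, so \<open>y\<close> has left \<open>b\<close>; by the choice of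
    \<open>x'\<close> it has left for good.\<close>
  have "a \<in> tp y" "a \<notin> tp x" using x y \<Sigma>_Poss[OF x(2)] by (simp_all add: tp_def)
  then have "\<not> holds R V y b" using b[OF yW] by (auto simp: P_def)
  then have y_not: "holds R V y (bBox (Neg b))"
    using x'(3) y(1) unfolding holds_Nec[of _ _ x'] holds.simps(3) holds_Neg by blast
  have x1y: "(x1, y) \<in> R Diamond" using x2(1) x'(1) y(1) D_trans by blast
  have never: "holds R V y (bBox (bAll (Neg b)))" using later[OF x1y] y_not by blast
  have "reach y \<subseteq> reach x"
    using reach_Diamond[OF x1y] reach_E[OF x1(2)] reach_Diamond[OF x1(1)] by simp
  moreover have "qs x \<in> reach x" by (auto simp: reach_def)
  moreover have "qs x \<notin> reach y"
  proof
    assume "qs x \<in> reach y"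
    then obtain z where z: "qs z = qs x" "z = y \<or> (y, z) \<in> R Diamond" by (auto simp: reach_def)
    then have yz: "(y, z) \<in> R Diamond" using refl[OF yW] by blast
    \<comment> \<open>A recurring quasi-state would bring the type of \<open>x\<close> with it,
      hence a point satisfying \<open>b\<close> in a cluster beyond \<open>y\<close>, against
      \<open>never\<close>.\<close>
    have "tp x \<in> qs z" using tp_in_qs[OF x(1)] z(1) by simp
    then obtain z' where z': "(z, z') \<in> R Exist" "tp z' = tp x" by (rule in_qsE)
    have "z' \<in> W" using z' rel_W by blast
    moreover have "P z'" using z' z qs_E[OF z'(1)] by (simp add: P_def)
    ultimately have "holds R V z' b" using b by blast
    then show False using never yz z'(1) unfolding holds_Nec holds_Neg by blast
  qed
  ultimately have "reach y \<subset> reach x" by blast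
  then show "\<exists>x' y. tp x' = tp x \<and> qs x' = qs x \<and> (x', y) \<in> R Diamond \<and> holds R V y a \<and>
      reach y \<subset> reach x"
    using Px' y by blast
qed (use refl in blast)

section \<open>The canonical model of a commutator\<close>

primrec subformulas :: "'m fm \<Rightarrow> 'm fm set" where
  "subformulas (Atom n) = {Atom n}"
| "subformulas Bot = {Bot}"
| "subformulas (a \<rightarrow>\<^sub>m b) = insert (a \<rightarrow>\<^sub>m b) (subformulas a \<union> subformulas b)"
| "subformulas (Poss m a) = insert (Poss m a) (subformulas a)"

lemma finite_subformulas: "finite (subformulas a)"
  by (induction a) auto

lemma self_subformula: "a \<in> subformulas a"
  by (cases a) auto

lemma subformulas_trans: "b \<in> subformulas a \<Longrightarrow> subformulas b \<subseteq> subformulas a"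
  by (induction a) auto

locale comm_logic = normal_logic L for L :: "bfm set" +
  assumes T_Exist: "(a \<rightarrow>\<^sub>m bEx a) \<in> L"
    and four_Exist: "(bEx (bEx a) \<rightarrow>\<^sub>m bEx a) \<in> L"
    and B_Exist: "(a \<rightarrow>\<^sub>m bAll (bEx a)) \<in> L"
    and comm1: "(bEx (bDia a) \<rightarrow>\<^sub>m bDia (bEx a)) \<in> L"
    and comm2: "(bDia (bEx a) \<rightarrow>\<^sub>m bEx (bDia a)) \<in> L"
begin

lemma equiv_can_rel: "equiv {S. mcs S} (can_rel Exist)"
proof (rule equivI)
  show "can_rel Exist \<subseteq> {S. mcs S} \<times> {S. mcs S}" by (auto simp: can_rel_def)
  show "refl_on {S. mcs S} (can_rel Exist)"
    using mcs_mp[OF _ mcs_ax[OF _ T_Exist]] by (auto simp: refl_on_def can_rel_def)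
  show "sym (can_rel Exist)"
  proof (rule symI)
    fix S T assume ST: "(S, T) \<in> can_rel Exist"
    then have S: "mcs S" and T: "mcs T" by (auto simp: can_rel_def)
    have "bEx a \<in> T" if a: "a \<in> S" for a
    proof (rule ccontr)
      assume "bEx a \<notin> T"
      then have "\<not> holds can_rel can_val T (bEx a)" using truth[OF T] by blast
      then have "\<not> holds can_rel can_val S (bAll (bEx a))"
        unfolding holds_Nec using ST by blast
      then have "bAll (bEx a) \<notin> S" using truth[OF S] by blast
      then show False using mcs_mp[OF S mcs_ax[OF S B_Exist] a] by blast
    qed
    then show "(T, S) \<in> can_rel Exist" using S T by (auto simp: can_rel_def)
  qed
  show "trans (can_rel Exist)"
  proof (rule transI)
    fix S T U assume "(S, T) \<in> can_rel Exist" "(T, U) \<in> can_rel Exist"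
    then have S: "mcs S" "mcs U" "\<And>a. a \<in> U \<Longrightarrow> bEx (bEx a) \<in> S" by (auto simp: can_rel_def)
    then have "bEx a \<in> S" if "a \<in> U" for a
      using mcs_mp[OF S(1) mcs_ax[OF S(1) four_Exist]] that by blast
    then show "(S, U) \<in> can_rel Exist" using S by (auto simp: can_rel_def)
  qed
qed

text \<open>Axiom 4 for \<open>bDia\<close> is a hypothesis because the Loeb and Grzegorczyk axioms
  yield it by different derivations.\<close>

lemma comm_model_canonical:
  assumes four: "\<And>a. (bDia (bDia a) \<rightarrow>\<^sub>m bDia a) \<in> L"
  shows "comm_model {S. mcs S} can_rel can_val (subformulas c)"
proof
  show "can_rel m \<subseteq> {S. mcs S} \<times> {S. mcs S}" for m by (auto simp: can_rel_def)
  show "trans (can_rel Diamond)"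
  proof (rule transI)
    fix S T U assume "(S, T) \<in> can_rel Diamond" "(T, U) \<in> can_rel Diamond"
    then have S: "mcs S" "mcs U" "\<And>a. a \<in> U \<Longrightarrow> bDia (bDia a) \<in> S" by (auto simp: can_rel_def)
    then have "bDia a \<in> S" if "a \<in> U" for a
      using mcs_mp[OF S(1) mcs_ax[OF S(1) four]] that by blast
    then show "(S, U) \<in> can_rel Diamond" using S by (auto simp: can_rel_def)
  qed
  show "equiv {S. mcs S} (can_rel Exist)" by (rule equiv_can_rel)
  show "holds can_rel can_val S (bEx (bDia a)) \<longleftrightarrow> holds can_rel can_val S (bDia (bEx a))"
    if "S \<in> {S. mcs S}" for S a
  proof -
    have S: "mcs S" using that by simp
    show ?thesis
      unfolding truth[OF S] using mcs_mp[OF S mcs_ax[OF S comm1]] mcs_mp[OF S mcs_ax[OF S comm2]]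
      by blast
  qed
  show "finite (subformulas c)" by (rule finite_subformulas)
  show "a \<in> subformulas c \<and> b \<in> subformulas c" if "a \<rightarrow>\<^sub>m b \<in> subformulas c" for a b
    using subformulas_trans[OF that] self_subformula[of a] self_subformula[of b] by auto
  show "a \<in> subformulas c" if "Poss m a \<in> subformulas c" for m a
    using subformulas_trans[OF that] self_subformula[of a] by auto
qed

lemma complete: "(\<And>S. mcs S \<Longrightarrow> holds can_rel can_val S a) \<Longrightarrow> a \<in> L"
  using canonical_refutation by blast

end

text \<open>\<open>\<Gamma>\<close> is left open so that both the commutator and its extension by
  the additional axiom are covered.\<close>

lemma comm_logic_closure:
  assumes K: "K \<subseteq> L" and \<Gamma>: "comm_S5 L \<subseteq> closure \<Gamma>"
  shows "comm_logic (closure \<Gamma>)"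
proof -
  have fusion: "fusion_S5 L \<subseteq> closure \<Gamma>"
    using \<Gamma> unfolding comm_S5_def extend_def by (auto intro: closure.incl)
  have S5: "subst (\<lambda>_. a) (map_fm (\<lambda>_. Exist) b) \<in> closure \<Gamma>" if "b \<in> S5" for a b
    using that fusion unfolding fusion_S5_def by (blast intro: closure.intros)
  have S5_ax: "Atom 0 \<rightarrow>\<^sub>m uDia (Atom 0) \<in> S5" "uDia (uDia (Atom 0)) \<rightarrow>\<^sub>m uDia (Atom 0) \<in> S5"
    "Atom 0 \<rightarrow>\<^sub>m uBox (uDia (Atom 0)) \<in> S5"
    unfolding S5_def extend_def by (auto intro: closure.incl)
  have comm: "bEx (bDia (Atom 0)) \<rightarrow>\<^sub>m bDia (bEx (Atom 0)) \<in> closure \<Gamma>"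
    "bDia (bEx (Atom 0)) \<rightarrow>\<^sub>m bEx (bDia (Atom 0)) \<in> closure \<Gamma>"
    using \<Gamma> unfolding comm_S5_def extend_def by (auto intro: closure.incl)
  interpret normal_logic "closure \<Gamma>"
    by (rule normal_logic_closure) (use K_subset_fusion[OF K] fusion in blast)
  show ?thesis
  proof
    fix a
    show "a \<rightarrow>\<^sub>m bEx a \<in> closure \<Gamma>" "bEx (bEx a) \<rightarrow>\<^sub>m bEx a \<in> closure \<Gamma>"
      "a \<rightarrow>\<^sub>m bAll (bEx a) \<in> closure \<Gamma>"
      using S5_ax[THEN S5, of a] by simp_all
    show "bEx (bDia a) \<rightarrow>\<^sub>m bDia (bEx a) \<in> closure \<Gamma>" "bDia (bEx a) \<rightarrow>\<^sub>m bEx (bDia a) \<in> closure \<Gamma>"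
      using comm[THEN closure.subst, of "\<lambda>_. a"] by simp_all
  qed
qed

lemma comm_S5_instance:
  assumes "b \<in> L"
  shows "subst \<sigma> (map_fm (\<lambda>_. Diamond) b) \<in> comm_S5 L"
proof -
  have "map_fm (\<lambda>_. Diamond) b \<in> comm_S5 L"
    using assms unfolding comm_S5_def extend_def fusion_S5_def by (auto intro!: closure.incl)
  then show ?thesis unfolding comm_S5_def extend_def by (rule closure.subst)
qed

section \<open>Completeness\<close>

lemma equiv_Times: "equiv A (A \<times> A)"
  by (auto simp: equiv_def refl_on_def sym_def trans_def)

lemma K_subset_extend: "K \<subseteq> extend K \<Delta>"
  unfolding extend_def by (auto intro: closure.incl)

lemma product_S5_GL_subset:
  assumes inf: "infinite (UNIV :: 'a set)" "infinite (UNIV :: 'b set)"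
  shows "product_S5 TYPE('a) TYPE('b) GL \<subseteq> comm_S5 GL"
proof
  fix \<phi> assume \<phi>: "\<phi> \<in> product_S5 TYPE('a) TYPE('b) GL"
  obtain \<Gamma> where \<Gamma>: "comm_S5 GL = closure \<Gamma>" unfolding comm_S5_def extend_def by blast
  interpret comm_logic "comm_S5 GL"
    unfolding \<Gamma> using \<Gamma> by (intro comm_logic_closure[of GL]) (simp_all add: GL_def K_subset_extend)
  have "uBox (uBox (Atom 0) \<rightarrow>\<^sub>m Atom 0) \<rightarrow>\<^sub>m uBox (Atom 0) \<in> GL"
    unfolding GL_def extend_def by (auto intro: closure.incl)
  then have "bBox (bBox a \<rightarrow>\<^sub>m a) \<rightarrow>\<^sub>m bBox a \<in> comm_S5 GL" for a
    using comm_S5_instance[of _ GL "\<lambda>_. a"] by fastforce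
  then have loeb: "holds can_rel can_val S (bBox (bBox a \<rightarrow>\<^sub>m a) \<rightarrow>\<^sub>m bBox a)" if "mcs S" for S a
    using canonical_sound[OF that] by blast
  have four: "bDia (bDia a) \<rightarrow>\<^sub>m bDia a \<in> comm_S5 GL" for a
  proof (rule complete)
    fix S assume "mcs S"
    \<comment> \<open>The usual derivation of axiom 4: Loeb's axiom is applied to the conjunction of
      \<open>c\<close> and \<open>bBox c\<close>, with \<open>Neg a\<close> for
      \<open>c\<close>.\<close>
    then show "holds can_rel can_val S (bDia (bDia a) \<rightarrow>\<^sub>m bDia a)"
      using loeb[of S "Neg (Neg a \<rightarrow>\<^sub>m bDia a)"] unfolding holds_Nec holds_Neg holds.simps by blast
  qed
  show "\<phi> \<in> comm_S5 GL"
  proof (rule complete, rule ccontr)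
    fix S assume S: "mcs S" "\<not> holds can_rel can_val S \<phi>"
    have pm: "progressive_model {S. mcs S} can_rel can_val (subformulas \<phi>) False"
      by (rule comm_model.progressive_GL[OF comm_model_canonical[OF four]]) (use loeb in blast)
    obtain X\<^sub>1 :: "'a set" and R\<^sub>1 and X\<^sub>2 :: "'b set" where
      R: "R\<^sub>1 \<subseteq> X\<^sub>1 \<times> X\<^sub>1" "trans R\<^sub>1" "wf ((R\<^sub>1 - Id)\<inverse>)" "irrefl R\<^sub>1"
      "\<not> valid (X\<^sub>1 \<times> X\<^sub>2) (prod_rel X\<^sub>1 R\<^sub>1 X\<^sub>2 (X\<^sub>2 \<times> X\<^sub>2)) \<phi>"
      using progressive_model.product_countermodel[OF pm inf, of S \<phi>] S self_subformula by auto
    have "R\<^sub>1 - Id = R\<^sub>1" using R(4) by (auto simp: irrefl_def)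
    then have "frame_for GL X\<^sub>1 R\<^sub>1" using R frame_for_GL by simp
    then show False using \<phi> R(5) equiv_Times unfolding product_S5_def by blast
  qed
qed

lemma product_S5_Grz_subset:
  assumes inf: "infinite (UNIV :: 'a set)" "infinite (UNIV :: 'b set)"
  shows "product_S5 TYPE('a) TYPE('b) Grz \<subseteq> MplusGrzB"
proof
  fix \<phi> assume \<phi>: "\<phi> \<in> product_S5 TYPE('a) TYPE('b) Grz"
  obtain \<Gamma> where \<Gamma>: "MplusGrzB = closure \<Gamma>" unfolding MplusGrzB_def extend_def by blast
  have sub: "comm_S5 Grz \<subseteq> MplusGrzB"
    unfolding MplusGrzB_def MGrzB_def extend_def by (auto intro: closure.incl)
  interpret comm_logic MplusGrzB
    unfolding \<Gamma> using \<Gamma> sub by (intro comm_logic_closure[of Grz]) (simp_all add: Grz_def K_subset_extend)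
  have "uBox (uBox (Atom 0 \<rightarrow>\<^sub>m uBox (Atom 0)) \<rightarrow>\<^sub>m Atom 0) \<rightarrow>\<^sub>m Atom 0 \<in> Grz"
    unfolding Grz_def extend_def by (auto intro: closure.incl)
  then have "subst (\<lambda>_. a) (map_fm (\<lambda>_. Diamond)
      (uBox (uBox (Atom 0 \<rightarrow>\<^sub>m uBox (Atom 0)) \<rightarrow>\<^sub>m Atom 0) \<rightarrow>\<^sub>m Atom 0)) \<in> MplusGrzB" for a
    using comm_S5_instance sub by blast
  then have "Grz_instance Diamond a \<in> MplusGrzB" for a by simp
  then have grz: "holds can_rel can_val S (Grz_instance Diamond a)" if "mcs S" for S a
    using canonical_sound[OF that] by blast
  have "bBox (bAll (bBox (bBox (Atom 0) \<rightarrow>\<^sub>m bBox (bAll (Atom 0))) \<rightarrow>\<^sub>m bBox (bAll (Atom 0))))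
      \<rightarrow>\<^sub>m bBox (bAll (Atom 0)) \<in> MplusGrzB"
    unfolding MplusGrzB_def extend_def by (auto intro: closure.incl)
  then have "subst (\<lambda>_. a)
      (bBox (bAll (bBox (bBox (Atom 0) \<rightarrow>\<^sub>m bBox (bAll (Atom 0))) \<rightarrow>\<^sub>m bBox (bAll (Atom 0))))
        \<rightarrow>\<^sub>m bBox (bAll (Atom 0))) \<in> MplusGrzB" for a
    unfolding \<Gamma> by (rule closure.subst)
  then have "bBox (bAll (bBox (bBox a \<rightarrow>\<^sub>m bBox (bAll a)) \<rightarrow>\<^sub>m bBox (bAll a))) \<rightarrow>\<^sub>m bBox (bAll a)
      \<in> MplusGrzB" for a
    by simp
  then have mplus: "holds can_rel can_val S
      (bBox (bAll (bBox (bBox a \<rightarrow>\<^sub>m bBox (bAll a)) \<rightarrow>\<^sub>m bBox (bAll a))) \<rightarrow>\<^sub>m bBox (bAll a))"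
    if "mcs S" for S a
    using canonical_sound[OF that] by blast
  have T: "a \<rightarrow>\<^sub>m bDia a \<in> MplusGrzB" for a
    by (rule complete) (use Grz_instance_reflexive[OF grz] in \<open>simp only: holds.simps(3)\<close>, blast)
  have refl: "(S, S) \<in> can_rel Diamond" if S: "mcs S" for S
    using mcs_mp[OF S mcs_ax[OF S T]] S unfolding can_rel_def by blast
  have four: "bDia (bDia a) \<rightarrow>\<^sub>m bDia a \<in> MplusGrzB" for a
  proof (rule complete)
    fix S assume S: "mcs S"
    show "holds can_rel can_val S (bDia (bDia a) \<rightarrow>\<^sub>m bDia a)"
      using Grz_instance_transitive[OF grz[OF S], of "Neg a"]
      unfolding holds_Nec holds_Neg holds.simps by blast
  qed
  show "\<phi> \<in> MplusGrzB"
  proof (rule complete, rule ccontr)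
    fix S assume S: "mcs S" "\<not> holds can_rel can_val S \<phi>"
    have pm: "progressive_model {S. mcs S} can_rel can_val (subformulas \<phi>) True"
      by (rule comm_model.progressive_Grz[OF comm_model_canonical[OF four]]) (use refl grz mplus in blast)+
    obtain X\<^sub>1 :: "'a set" and R\<^sub>1 and X\<^sub>2 :: "'b set" where
      R: "R\<^sub>1 \<subseteq> X\<^sub>1 \<times> X\<^sub>1" "trans R\<^sub>1" "wf ((R\<^sub>1 - Id)\<inverse>)" "refl_on X\<^sub>1 R\<^sub>1"
      "\<not> valid (X\<^sub>1 \<times> X\<^sub>2) (prod_rel X\<^sub>1 R\<^sub>1 X\<^sub>2 (X\<^sub>2 \<times> X\<^sub>2)) \<phi>"
      using progressive_model.product_countermodel[OF pm inf, of S \<phi>] S self_subformula by auto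
    have "frame_for Grz X\<^sub>1 R\<^sub>1" by (rule frame_for_Grz[OF R(1,4,2,3)])
    then show False using \<phi> R(5) equiv_Times unfolding product_S5_def by blast
  qed
qed

theorem theorem5p5:
  assumes "infinite (UNIV :: 'a set)" and "infinite (UNIV :: 'b set)"
  shows "product_matching TYPE('a) TYPE('b) GL \<and>
         product_S5 TYPE('a) TYPE('b) GL = comm_S5 GL \<and> comm_S5 GL = MGLB \<and>
         product_S5 TYPE('a) TYPE('b) Grz = MplusGrzB"
proof -
  have "product_S5 TYPE('a) TYPE('b) GL = comm_S5 GL"
    using product_S5_GL_subset[OF assms] prod_valid_comm_S5 unfolding product_S5_def by blast
  moreover have "product_S5 TYPE('a) TYPE('b) Grz = MplusGrzB"
    using product_S5_Grz_subset[OF assms] prod_valid_MplusGrzB unfolding product_S5_def by blast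
  ultimately show ?thesis by (simp add: product_matching_def MGLB_def)
qed

end
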